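(* Let $a>0$ and let $V=\ell^2(\mathbb{Z}_+)$ be the $\mathfrak{osp}(1|2)$ representation space with parameter $a$. In $V$, the momentum operator $\hat p=\frac{i(b^+-b^-)}{\sqrt2}$ has formal eigenvectors $$w(p)=\sum_{n=0}^\infty i^n\beta_n(p)\,e_n,$$ with eigenvalue $p$, where $$\beta_{2n}(p)=(-1)^n\sqrt{\frac{(a)_n}{n!}}\;\frac{|p|^{a-\frac12}e^{-p^2/2}}{\sqrt{\Gamma(a)}}\;{}_1F_1(-n;a;p^2),$$ $$\beta_{2n+1}(p)=(-1)^n\sqrt{\frac{(a+1)_n}{n!}}\;\frac{p|p|^{a-\frac12}e^{-p^2/2}}{\sqrt{\Gamma(a+1)}}\;{}_1F_1(-n;a+1;p^2).$$ Just like the position operator $\hat x=\frac{b^++b^-}{\sqrt2}$, $\hat p$ has a spectrum in $V$ that is equal to $\mathbb{R}$.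
   Context: Representation space: $V=\ell^2(\mathbb{Z}_+)$ is the Hilbert space of square-summable complex sequences with orthonormal standard basis $e_0,e_1,e_2,\dots$. For $a>0$ the positive discrete series representation of $\mathfrak{osp}(1|2)$ with parameter $a$ is given by operators $b^\pm$ acting on basis vectors by $$b^+e_{2n}=\sqrt{2(n+a)}\,e_{2n+1},\quad b^-e_{2n}=\sqrt{2n}\,e_{2n-1},\quad b^+e_{2n+1}=\sqrt{2(n+1)}\,e_{2n+2},\quad b^-e_{2n+1}=\sqrt{2(n+a)}\,e_{2n}$$ (with $b^-e_0=0$). The operators $\hat x$ and $\hat p$ act in $V$ as unbounded self-adjoint operators. A formal eigenvector of $\hat p$ with eigenvalue $p$ is a formal series $w(p)=\sum_n\gamma_n(p)e_n$ (not necessarily in $\ell^2$) satisfying $\hat p\,w(p)=p\,w(p)$, where $\hat p$ is applied term by term and coefficients of each $e_n$ are compared. $(c)_n=c(c+1)\cdots(c+n-1)$ is the Pochhammer symbol, and ${}_1F_1(-n;c;z)=\sum_{k=0}^n\frac{(-n)_k}{(c)_k\,k!}z^k$. *)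

theory Defs
  imports "HOL-Analysis.Analysis"
begin

section \<open>Formal series in the standard basis\<close>

text \<open>
  A sequence \<open>v :: nat \<Rightarrow> complex\<close> stands for the formal series \<open>\<Sum>n. v n e\<^sub>n\<close>;
  it is an element of the Hilbert space \<open>V\<close> iff it is square-summable.
\<close>

definition basis_vec :: "nat \<Rightarrow> nat \<Rightarrow> complex" where
  "basis_vec n = (\<lambda>m. if m = n then 1 else 0)"

text \<open>
  Term-by-term application of the operator with \<open>e\<^sub>n \<mapsto> B n\<close>: the coefficient of \<open>e\<^sub>m\<close> collects
  the contributions of all \<open>e\<^sub>n\<close> whose image involves \<open>e\<^sub>m\<close>.  For the operators below at most
  one \<open>n\<close> contributes to each \<open>m\<close>, so these sums are finite.
\<close>

definition formal_ext :: "(nat \<Rightarrow> nat \<Rightarrow> complex) \<Rightarrow> (nat \<Rightarrow> complex) \<Rightarrow> nat \<Rightarrow> complex" where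
  "formal_ext B v = (\<lambda>m. \<Sum>n\<in>{n. B n m \<noteq> 0}. v n * B n m)"

definition formal_eigenvector ::
  "((nat \<Rightarrow> complex) \<Rightarrow> (nat \<Rightarrow> complex)) \<Rightarrow> complex \<Rightarrow> (nat \<Rightarrow> complex) \<Rightarrow> bool" where
  "formal_eigenvector T z w \<longleftrightarrow> T w = (\<lambda>n. z * w n)"


section \<open>The positive discrete series representation of osp(1|2)\<close>

definition b_plus_basis :: "real \<Rightarrow> nat \<Rightarrow> nat \<Rightarrow> complex" where
  "b_plus_basis a k =
     (let n = k div 2 in
      if even k then (\<lambda>m. complex_of_real (sqrt (2 * (real n + a))) * basis_vec (2 * n + 1) m)
      else (\<lambda>m. complex_of_real (sqrt (2 * (real n + 1))) * basis_vec (2 * n + 2) m))"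

text \<open>
  For \<open>k = 0\<close> the truncated index \<open>2 * n - 1\<close> is irrelevant, since the coefficient vanishes.
\<close>

definition b_minus_basis :: "real \<Rightarrow> nat \<Rightarrow> nat \<Rightarrow> complex" where
  "b_minus_basis a k =
     (let n = k div 2 in
      if even k then (\<lambda>m. complex_of_real (sqrt (2 * real n)) * basis_vec (2 * n - 1) m)
      else (\<lambda>m. complex_of_real (sqrt (2 * (real n + a))) * basis_vec (2 * n) m))"

definition b_plus :: "real \<Rightarrow> (nat \<Rightarrow> complex) \<Rightarrow> nat \<Rightarrow> complex" where
  "b_plus a = formal_ext (b_plus_basis a)"

definition b_minus :: "real \<Rightarrow> (nat \<Rightarrow> complex) \<Rightarrow> nat \<Rightarrow> complex" where
  "b_minus a = formal_ext (b_minus_basis a)"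

definition x_hat :: "real \<Rightarrow> (nat \<Rightarrow> complex) \<Rightarrow> nat \<Rightarrow> complex" where
  "x_hat a v = (\<lambda>m. (b_plus a v m + b_minus a v m) / complex_of_real (sqrt 2))"

definition p_hat :: "real \<Rightarrow> (nat \<Rightarrow> complex) \<Rightarrow> nat \<Rightarrow> complex" where
  "p_hat a v = (\<lambda>m. \<i> * (b_plus a v m - b_minus a v m) / complex_of_real (sqrt 2))"


section \<open>The Hilbert space and unbounded operators on it\<close>

definition ell2 :: "(nat \<Rightarrow> complex) set" where
  "ell2 = {v. summable (\<lambda>n. (norm (v n))\<^sup>2)}"

definition ell2_norm :: "(nat \<Rightarrow> complex) \<Rightarrow> real" where
  "ell2_norm v = sqrt (\<Sum>n. (norm (v n))\<^sup>2)"

definition ell2_tendsto :: "(nat \<Rightarrow> nat \<Rightarrow> complex) \<Rightarrow> (nat \<Rightarrow> complex) \<Rightarrow> bool" where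
  "ell2_tendsto u v \<longleftrightarrow> (\<lambda>j. ell2_norm (\<lambda>n. u j n - v n)) \<longlonglongrightarrow> 0"

text \<open>
  An unbounded operator is given by its graph.  The operator in \<open>V\<close> determined by the action
  of \<open>T\<close> on basis vectors is the closure of \<open>T\<close> on the finite linear combinations of basis vectors.
  \<open>x_hat a\<close> and \<open>p_hat a\<close> are Jacobi operators whose off-diagonal entries grow like the square
  root of the index, hence essentially self-adjoint there (Carleman's condition): the closure is
  their unique self-adjoint realization, and its domain is the set of all \<open>v \<in> ell2\<close> for which
  the formal series \<open>T v\<close> is again in \<open>ell2\<close>.
\<close>

definition finite_graph ::
  "((nat \<Rightarrow> complex) \<Rightarrow> (nat \<Rightarrow> complex)) \<Rightarrow> ((nat \<Rightarrow> complex) \<times> (nat \<Rightarrow> complex)) set" where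
  "finite_graph T = {(v, T v) | v. finite {n. v n \<noteq> 0}}"

definition closure_graph ::
  "((nat \<Rightarrow> complex) \<Rightarrow> (nat \<Rightarrow> complex)) \<Rightarrow> ((nat \<Rightarrow> complex) \<times> (nat \<Rightarrow> complex)) set" where
  "closure_graph T =
     {(u, v). u \<in> ell2 \<and> v \<in> ell2 \<and>
        (\<exists>us vs. (\<forall>j. (us j, vs j) \<in> finite_graph T) \<and> ell2_tendsto us u \<and> ell2_tendsto vs v)}"

text \<open>
  \<open>z\<close> is in the resolvent set iff \<open>T - z\<close> maps the domain of \<open>T\<close> bijectively onto \<open>V\<close> with
  bounded inverse.
\<close>

definition resolvent_set :: "((nat \<Rightarrow> complex) \<times> (nat \<Rightarrow> complex)) set \<Rightarrow> complex set" where
  "resolvent_set G =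
     {z. (\<forall>f\<in>ell2. \<exists>!u. \<exists>v. (u, v) \<in> G \<and> (\<lambda>n. v n - z * u n) = f) \<and>
         (\<exists>C. \<forall>(u, v)\<in>G. ell2_norm u \<le> C * ell2_norm (\<lambda>n. v n - z * u n))}"

definition op_spectrum :: "((nat \<Rightarrow> complex) \<times> (nat \<Rightarrow> complex)) set \<Rightarrow> complex set" where
  "op_spectrum G = - resolvent_set G"


section \<open>The coefficients of the formal eigenvectors\<close>

definition hyp1F1 :: "nat \<Rightarrow> real \<Rightarrow> real \<Rightarrow> real" where
  "hyp1F1 n c z = (\<Sum>k\<le>n. pochhammer (- real n) k / (pochhammer c k * fact k) * z ^ k)"

text \<open>
  The factor \<open>\<bar>p\<bar>\<^sup>s\<close>.  The library has \<open>0 powr 0 = 0\<close>, whereas here the zeroth power is \<open>1\<close>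
  throughout.  For \<open>s < 0\<close> the value at \<open>p = 0\<close>, undefined in ordinary usage, is \<open>0\<close>.
\<close>

definition abs_pow :: "real \<Rightarrow> real \<Rightarrow> real" where
  "abs_pow p s = (if s = 0 then 1 else \<bar>p\<bar> powr s)"

definition beta :: "real \<Rightarrow> nat \<Rightarrow> real \<Rightarrow> real" where
  "beta a k p =
     (let n = k div 2 in
      if even k then
        (-1) ^ n * sqrt (pochhammer a n / fact n)
          * (abs_pow p (a - 1/2) * exp (- (p\<^sup>2) / 2) / sqrt (Gamma a))
          * hyp1F1 n a (p\<^sup>2)
      else
        (-1) ^ n * sqrt (pochhammer (a + 1) n / fact n)
          * (p * abs_pow p (a - 1/2) * exp (- (p\<^sup>2) / 2) / sqrt (Gamma (a + 1)))
          * hyp1F1 n (a + 1) (p\<^sup>2))"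

definition w_vec :: "real \<Rightarrow> real \<Rightarrow> nat \<Rightarrow> complex" where
  "w_vec a p = (\<lambda>n. \<i> ^ n * complex_of_real (beta a n p))"

end

theory Submission
  imports Defs
begin

text \<open>
  Conjugation by \<open>diag(i^n)\<close> turns \<open>p_hat\<close> into \<open>x_hat\<close>, a Jacobi operator whose squared off-diagonal
  entries \<open>(d m)\<^sup>2\<close> grow linearly with bounded increments.  For such operators, cutoffs of slope \<open>1 / N\<close>
  have commutators of norm \<open>O(1 / sqrt N)\<close>.  This identifies the closure with the maximal operator,
  and non-real \<open>z\<close> are resolvent points because the truncated symmetric problem bounds the formal
  solutions.  For real \<open>l\<close> the quantity
  \<open>(d m)\<^sup>2 * ((x m)\<^sup>2 + (x (Suc m))\<^sup>2) - l * d m * x m * x (Suc m)\<close> of a formal eigenvector \<open>x\<close> is almost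
  conserved, so its partial square sums satisfy a doubling bound and its cutoffs form a Weyl sequence.
\<close>

section \<open>Square-summable sequences\<close>

text \<open>The spectral part cannot rest on \<open>w_vec\<close> alone: at \<open>p = 0\<close> it
  vanishes unless \<open>a = 1/2\<close>, and cutting off the explicit coefficients would call for
  their asymptotics in \<open>n\<close>. Instead, each real \<open>l\<close> gets the real formal
  solution with initial value 1, and only the ratio of its partial square sums
  \<open>S (2 * M)\<close> and \<open>S M\<close> matters. The residual of the cut-off solution has
  order \<open>sqrt (S (2 * M) / M)\<close>, its norm is at least \<open>sqrt (S M)\<close>, so a
  ratio bounded in \<open>M\<close> contradicts a bounded inverse. The bound is a discrete Gronwall
  argument: since the squares of \<open>d\<close> grow linearly, each new square is at most a
  constant over \<open>M\<close> times the sum so far. The explicit coefficients serve the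
  eigenvector equation, which two contiguous relations settle row by row.\<close>

lemma L2_set_le_ell2_norm:
  assumes "u \<in> ell2" "finite A"
  shows "L2_set (\<lambda>n. norm (u n)) A \<le> ell2_norm u"
  unfolding L2_set_def ell2_norm_def using assms
  by (auto simp: ell2_def intro!: real_sqrt_le_mono sum_le_suminf)

lemma ell2_norm_nonneg:
  assumes "u \<in> ell2" shows "0 \<le> ell2_norm u"
  using L2_set_le_ell2_norm[OF assms, of "{}"] by simp

lemma norm_le_ell2_norm:
  assumes "u \<in> ell2" shows "norm (u n) \<le> ell2_norm u"
  using L2_set_le_ell2_norm[OF assms, of "{n}"] by (simp add: L2_set_def)

text \<open>Norm estimates are made on finite truncations, where Minkowski and Cauchy-Schwarz for
  \<open>L2_set\<close> apply. This passes to the limit and supplies summability as well, without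
  which the \<open>suminf\<close> in \<open>ell2_norm\<close> says nothing.\<close>

lemma ell2_bounded_partial:
  assumes "\<And>N. L2_set (\<lambda>n. norm (u n)) {..N} \<le> B"
  shows "u \<in> ell2" and "ell2_norm u \<le> B"
proof -
  have B: "0 \<le> B" using order_trans[OF L2_set_nonneg assms] .
  have le: "(\<Sum>n\<le>N. (norm (u n))\<^sup>2) \<le> B\<^sup>2" for N
    using assms[of N] unfolding L2_set_def by (metis B real_sqrt_le_iff real_sqrt_unique)
  have s: "summable (\<lambda>n. (norm (u n))\<^sup>2)"
    by (rule bounded_imp_summable[OF _ le]) simp
  then show "u \<in> ell2" by (simp add: ell2_def)
  have "(\<Sum>n. (norm (u n))\<^sup>2) \<le> B\<^sup>2"
  proof (rule suminf_le_const[OF s])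
    fix n
    have "(\<Sum>n<n. (norm (u n))\<^sup>2) \<le> (\<Sum>n\<le>n. (norm (u n))\<^sup>2)"
      by (rule sum_mono2) auto
    then show "(\<Sum>n<n. (norm (u n))\<^sup>2) \<le> B\<^sup>2" using le order_trans by blast
  qed
  then show "ell2_norm u \<le> B" unfolding ell2_norm_def using B
    by (metis real_sqrt_le_iff real_sqrt_abs abs_of_nonneg)
qed

lemma ell2_add:
  assumes u: "u \<in> ell2" and v: "v \<in> ell2"
  shows "(\<lambda>n. u n + v n) \<in> ell2"
    and "ell2_norm (\<lambda>n. u n + v n) \<le> ell2_norm u + ell2_norm v"
proof -
  have "L2_set (\<lambda>n. norm (u n + v n)) {..N} \<le> ell2_norm u + ell2_norm v" for N
  proof -
    have "L2_set (\<lambda>n. norm (u n + v n)) {..N} \<le> L2_set (\<lambda>n. norm (u n) + norm (v n)) {..N}"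
      by (rule L2_set_mono) (auto intro: norm_triangle_ineq)
    also have "\<dots> \<le> L2_set (\<lambda>n. norm (u n)) {..N} + L2_set (\<lambda>n. norm (v n)) {..N}"
      by (rule L2_set_triangle_ineq)
    also have "\<dots> \<le> ell2_norm u + ell2_norm v"
      by (intro add_mono L2_set_le_ell2_norm u v) auto
    finally show ?thesis .
  qed
  from ell2_bounded_partial[OF this]
  show "(\<lambda>n. u n + v n) \<in> ell2" "ell2_norm (\<lambda>n. u n + v n) \<le> ell2_norm u + ell2_norm v" .
qed

lemma ell2_norm_cmult: "ell2_norm (\<lambda>n. c * u n) = norm c * ell2_norm u" if "u \<in> ell2"
  using that by (simp add: ell2_norm_def ell2_def norm_mult power_mult_distrib suminf_mult real_sqrt_mult)

lemma ell2_cmult: "u \<in> ell2 \<Longrightarrow> (\<lambda>n. c * u n) \<in> ell2"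
  by (simp add: ell2_def norm_mult power_mult_distrib summable_mult)

lemma ell2_diff:
  assumes "u \<in> ell2" "v \<in> ell2"
  shows "(\<lambda>n. u n - v n) \<in> ell2"
    and "ell2_norm (\<lambda>n. u n - v n) \<le> ell2_norm u + ell2_norm v"
  using ell2_add[OF assms(1) ell2_cmult[OF assms(2), of "-1"]] ell2_norm_cmult[OF assms(2), of "-1"]
  by simp_all

lemma ell2_norm_minus_commute: "ell2_norm (\<lambda>n. u n - v n) = ell2_norm (\<lambda>n. v n - u n)"
  by (simp add: ell2_norm_def norm_minus_commute)

lemma ell2_finite:
  assumes "finite {n. u n \<noteq> 0}" shows "u \<in> ell2"
  unfolding ell2_def using assms by (auto intro!: summable_finite[of "{n. u n \<noteq> 0}"])

lemma ell2_norm_finite_support: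
  assumes "\<And>n. N < n \<Longrightarrow> u n = 0"
  shows "ell2_norm u = L2_set (\<lambda>n. norm (u n)) {..N}"
proof -
  have "(\<Sum>n. (norm (u n))\<^sup>2) = (\<Sum>n\<le>N. (norm (u n))\<^sup>2)"
    by (rule suminf_finite) (auto simp: assms not_le)
  then show ?thesis by (simp add: ell2_norm_def L2_set_def)
qed

lemma ell2_norm_tendsto:
  assumes us: "\<And>j. us j \<in> ell2" and u: "u \<in> ell2" and "ell2_tendsto us u"
  shows "(\<lambda>j. ell2_norm (us j)) \<longlonglongrightarrow> ell2_norm u"
proof -
  have "\<bar>ell2_norm (us j) - ell2_norm u\<bar> \<le> ell2_norm (\<lambda>n. us j n - u n)" for j
    using ell2_add(2)[OF ell2_diff(1)[OF us u] u, of j] ell2_add(2)[OF ell2_diff(1)[OF u us] us, of j j]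
    by (simp add: ell2_norm_minus_commute[of u])
  then have "(\<lambda>j. ell2_norm (us j) - ell2_norm u) \<longlonglongrightarrow> 0"
    using assms(3)[unfolded ell2_tendsto_def]
    by - (rule Lim_null_comparison[OF always_eventually], auto)
  then show ?thesis by (simp add: LIM_zero_iff)
qed

lemma ell2_tendsto_coordinate:
  assumes us: "\<And>j. us j \<in> ell2" and u: "u \<in> ell2" and "ell2_tendsto us u"
  shows "(\<lambda>j. us j n) \<longlonglongrightarrow> u n"
proof -
  have "norm (us j n - u n) \<le> ell2_norm (\<lambda>n. us j n - u n)" for j
    using norm_le_ell2_norm[OF ell2_diff(1)[OF us u]] .
  then have "(\<lambda>j. us j n - u n) \<longlonglongrightarrow> 0"
    using assms(3)[unfolded ell2_tendsto_def]
    by - (rule Lim_null_comparison[OF always_eventually], auto)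
  then show ?thesis by (simp add: LIM_zero_iff)
qed

lemma ell2_tendsto_diff:
  assumes us: "\<And>j. us j \<in> ell2" "u \<in> ell2" "ell2_tendsto us u"
    and vs: "\<And>j. vs j \<in> ell2" "v \<in> ell2" "ell2_tendsto vs v"
  shows "ell2_tendsto (\<lambda>j n. vs j n - z * us j n) (\<lambda>n. v n - z * u n)"
proof -
  have le: "ell2_norm (\<lambda>n. (vs j n - z * us j n) - (v n - z * u n))
      \<le> ell2_norm (\<lambda>n. vs j n - v n) + norm z * ell2_norm (\<lambda>n. us j n - u n)" for j
    using ell2_diff(2)[OF ell2_diff(1)[OF vs(1,2)] ell2_cmult[OF ell2_diff(1)[OF us(1,2)], of z], of j j]
    unfolding ell2_norm_cmult[OF ell2_diff(1)[OF us(1,2)]] by (simp add: algebra_simps)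
  have lim: "(\<lambda>j. ell2_norm (\<lambda>n. vs j n - v n) + norm z * ell2_norm (\<lambda>n. us j n - u n)) \<longlonglongrightarrow> 0"
    using us(3) vs(3) unfolding ell2_tendsto_def
    by (auto intro!: tendsto_eq_intros)
  have "(\<lambda>n. (vs j n - z * us j n) - (v n - z * u n)) \<in> ell2" for j
    by (intro ell2_diff(1) ell2_cmult us vs)
  then have "0 \<le> ell2_norm (\<lambda>n. (vs j n - z * us j n) - (v n - z * u n))" for j
    by (rule ell2_norm_nonneg)
  then show ?thesis unfolding ell2_tendsto_def
    by (intro tendsto_sandwich[OF _ _ tendsto_const lim]) (auto intro: always_eventually le)
qed

text \<open>Only entries with \<open>n > j\<close> change, each by \<open>u n\<close> times a factor
  of modulus at most 1, so the squared error is dominated by the tail of a convergent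
  series.\<close>

lemma ell2_tendsto_cutoff:
  fixes c :: "nat \<Rightarrow> nat \<Rightarrow> real"
  assumes u: "u \<in> ell2" and one: "\<And>j n. n \<le> j \<Longrightarrow> c j n = 1"
    and bd: "\<And>j n. 0 \<le> c j n" "\<And>j n. c j n \<le> 1"
  shows "ell2_tendsto (\<lambda>j n. of_real (c j n) * u n) u"
proof -
  let ?f = "\<lambda>n. (norm (u n))\<^sup>2"
  have s: "summable ?f" using u by (simp add: ell2_def)
  have pw: "(norm (of_real (c j n) * u n - u n))\<^sup>2 \<le> ?f n - (if n \<in> {..j} then ?f n else 0)" for j n
  proof (cases "n \<le> j")
    case False
    have "norm (of_real (c j n) * u n - u n) = norm ((of_real (c j n - 1) :: complex)) * norm (u n)"
      by (subst norm_mult[symmetric]) (simp add: algebra_simps)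
    also have "\<dots> \<le> 1 * norm (u n)"
      unfolding norm_of_real using bd[of j n] by (intro mult_right_mono) auto
    finally show ?thesis using False by (simp add: power_mono)
  qed (simp add: one)
  have sj: "(\<lambda>n. if n \<in> {..j} then ?f n else 0) sums (\<Sum>n\<le>j. ?f n)" for j
    using sums_If_finite_set[of "{..j}" ?f] by simp
  have sd: "(\<lambda>n. ?f n - (if n \<in> {..j} then ?f n else 0)) sums (suminf ?f - (\<Sum>n\<le>j. ?f n))" for j
    using sums_diff[OF summable_sums[OF s] sj] .
  have summ: "summable (\<lambda>n. (norm (of_real (c j n) * u n - u n))\<^sup>2)" for j
    by (rule summable_comparison_test'[OF sums_summable[OF sd[of j]], of 0])
      (simp only: real_norm_def abs_power2 pw)
  have "(\<Sum>n. (norm (of_real (c j n) * u n - u n))\<^sup>2) \<le> suminf ?f - (\<Sum>n\<le>j. ?f n)" for j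
    unfolding sums_unique[OF sd] by (intro suminf_le pw summ sums_summable[OF sd])
  then have le: "ell2_norm (\<lambda>n. of_real (c j n) * u n - u n) \<le> sqrt (suminf ?f - (\<Sum>n\<le>j. ?f n))" for j
    unfolding ell2_norm_def by simp
  have "(\<lambda>j. sqrt (suminf ?f - (\<Sum>n\<le>j. ?f n))) \<longlonglongrightarrow> sqrt (suminf ?f - suminf ?f)"
    using summable_LIMSEQ'[OF s] by (intro tendsto_intros)
  then have lim: "(\<lambda>j. sqrt (suminf ?f - (\<Sum>n\<le>j. ?f n))) \<longlonglongrightarrow> 0" by simp
  have "(\<lambda>n. of_real (c j n) * u n - u n) \<in> ell2" for j
    unfolding ell2_def using summ by simp
  then have "0 \<le> ell2_norm (\<lambda>n. of_real (c j n) * u n - u n)" for j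
    by (rule ell2_norm_nonneg)
  then show ?thesis unfolding ell2_tendsto_def
    by (intro tendsto_sandwich[OF _ _ tendsto_const lim]) (auto intro: always_eventually le)
qed

lemma L2_set_atMost_Suc_shift:
  fixes f :: "nat \<Rightarrow> real"
  shows "L2_set (\<lambda>m. case m of 0 \<Rightarrow> 0 | Suc k \<Rightarrow> f k) {..N} \<le> L2_set f {..N}"
    and "L2_set (\<lambda>m. f (Suc m)) {..N} \<le> L2_set f {..Suc N}"
proof -
  have "(\<Sum>m\<le>N. (case m of 0 \<Rightarrow> 0 | Suc k \<Rightarrow> f k)\<^sup>2) \<le> (\<Sum>m\<le>Suc N. (case m of 0 \<Rightarrow> 0 | Suc k \<Rightarrow> f k)\<^sup>2)"
    by (rule sum_mono2) auto
  also have "\<dots> = (\<Sum>m\<le>N. (f m)\<^sup>2)" by (simp only: sum.atMost_Suc_shift) simp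
  finally show "L2_set (\<lambda>m. case m of 0 \<Rightarrow> 0 | Suc k \<Rightarrow> f k) {..N} \<le> L2_set f {..N}"
    unfolding L2_set_def by simp
  show "L2_set (\<lambda>m. f (Suc m)) {..N} \<le> L2_set f {..Suc N}"
    unfolding L2_set_def by (simp only: sum.atMost_Suc_shift) simp
qed

text \<open>Both shifts of \<open>norm (u n)\<close> are contractions in the square norm; hence the
  factor 2.\<close>

lemma ell2_norm_neighbour_bound:
  assumes u: "u \<in> ell2" and e: "0 \<le> e"
    and R: "\<And>m. norm (R m) \<le> e * ((case m of 0 \<Rightarrow> 0 | Suc k \<Rightarrow> norm (u k)) + norm (u (Suc m)))"
  shows "R \<in> ell2" and "ell2_norm R \<le> 2 * e * ell2_norm u"
proof -
  have "L2_set (\<lambda>m. norm (R m)) {..N} \<le> 2 * e * ell2_norm u" for N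
  proof -
    let ?p = "\<lambda>m. case m of 0 \<Rightarrow> 0 | Suc k \<Rightarrow> norm (u k)"
    have "L2_set (\<lambda>m. norm (R m)) {..N} \<le> L2_set (\<lambda>m. e * (?p m + norm (u (Suc m)))) {..N}"
      by (rule L2_set_mono) (use R in auto)
    also have "\<dots> = e * L2_set (\<lambda>m. ?p m + norm (u (Suc m))) {..N}"
      using e by (simp add: L2_set_right_distrib)
    also have "\<dots> \<le> e * (L2_set ?p {..N} + L2_set (\<lambda>m. norm (u (Suc m))) {..N})"
      by (intro mult_left_mono L2_set_triangle_ineq e)
    also have "\<dots> \<le> e * (L2_set (\<lambda>m. norm (u m)) {..N} + L2_set (\<lambda>m. norm (u m)) {..Suc N})"
      by (intro mult_left_mono add_mono L2_set_atMost_Suc_shift e)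
    also have "\<dots> \<le> e * (ell2_norm u + ell2_norm u)"
      by (intro mult_left_mono add_mono L2_set_le_ell2_norm u e) auto
    finally show ?thesis by simp
  qed
  from ell2_bounded_partial[OF this] show "R \<in> ell2" "ell2_norm R \<le> 2 * e * ell2_norm u" .
qed


section \<open>Jacobi operators\<close>

definition jacobi :: "(nat \<Rightarrow> real) \<Rightarrow> (nat \<Rightarrow> complex) \<Rightarrow> nat \<Rightarrow> complex" where
  "jacobi d u m =
     (case m of 0 \<Rightarrow> 0 | Suc k \<Rightarrow> of_real (d k) * u k) + of_real (d m) * u (Suc m)"

lemma jacobi_0: "jacobi d u 0 = of_real (d 0) * u (Suc 0)"
  and jacobi_Suc: "jacobi d u (Suc m) = of_real (d m) * u m + of_real (d (Suc m)) * u (Suc (Suc m))"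
  by (simp_all add: jacobi_def)

lemma jacobi_diff: "jacobi d (\<lambda>n. u n - v n) m = jacobi d u m - jacobi d v m"
  by (cases m) (simp_all add: jacobi_0 jacobi_Suc algebra_simps)

lemma finite_support_jacobi:
  assumes "finite {n. u n \<noteq> 0}" shows "finite {n. jacobi d u n \<noteq> 0}"
proof (rule finite_subset)
  let ?A = "{n. u n \<noteq> 0}"
  show "finite (Suc ` ?A \<union> Suc -` ?A)"
    using assms by (intro finite_UnI finite_imageI finite_vimageI) auto
  show "{n. jacobi d u n \<noteq> 0} \<subseteq> Suc ` ?A \<union> Suc -` ?A"
    proof
    fix n assume "n \<in> {n. jacobi d u n \<noteq> 0}"
    then show "n \<in> Suc ` ?A \<union> Suc -` ?A"
      by (cases n) (auto simp: jacobi_0 jacobi_Suc)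
  qed
qed

text \<open>The commutator with multiplication by \<open>c\<close> has entries
  \<open>d m * (c (Suc m) - c m)\<close> up to sign beside the diagonal, and these vanish for
  \<open>m \<ge> N\<close>. So only the entries of \<open>u\<close> up to \<open>N\<close> count,
  and \<open>u\<close> may be any formal series, in particular a formal eigenvector.\<close>

lemma jacobi_commutator_bound:
  fixes c :: "nat \<Rightarrow> real" and u :: "nat \<Rightarrow> complex"
  assumes d: "\<And>m. 0 \<le> d m" "\<And>m. m \<le> N \<Longrightarrow> d m \<le> D"
    and lip: "\<And>n. \<bar>c (Suc n) - c n\<bar> \<le> e" and zero: "\<And>n. N \<le> n \<Longrightarrow> c n = 0"
  defines "R \<equiv> \<lambda>m. jacobi d (\<lambda>n. of_real (c n) * u n) m - of_real (c m) * jacobi d u m"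
  shows "R \<in> ell2" and "ell2_norm R \<le> 2 * (e * D) * L2_set (\<lambda>n. norm (u n)) {..N}"
proof -
  define w where "w = (\<lambda>n. if n \<le> N then u n else 0)"
  have w: "w \<in> ell2" by (rule ell2_finite) (simp add: w_def)
  have e: "0 \<le> e" using lip[of 0] by linarith
  have D: "0 \<le> D" using d(1)[of 0] d(2)[of 0] by simp
  have up: "norm (of_real (d m) * (of_real (c (Suc m)) * u (Suc m)) - of_real (c m) * (of_real (d m) * u (Suc m)))
      \<le> e * D * norm (w (Suc m))" for m
  proof (cases "m < N")
    case True
    have "norm (of_real (d m) * (of_real (c (Suc m)) * u (Suc m)) - of_real (c m) * (of_real (d m) * u (Suc m)))
       = norm (of_real (d m * (c (Suc m) - c m)) * u (Suc m))"
      by (simp add: algebra_simps)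
    also have "\<dots> = (\<bar>c (Suc m) - c m\<bar> * d m) * norm (u (Suc m))"
      unfolding norm_mult norm_of_real using d(1)[of m] by (simp add: abs_mult)
    also have "\<dots> \<le> (e * D) * norm (u (Suc m))"
      using True by (intro mult_right_mono mult_mono lip d e) auto
    finally show ?thesis using True by (simp add: w_def)
  qed (use e D in \<open>simp add: zero\<close>)
  have down: "norm (of_real (d m) * (of_real (c m) * u m) - of_real (c (Suc m)) * (of_real (d m) * u m))
      \<le> e * D * norm (w m)" for m
  proof (cases "m < N")
    case True
    have "norm (of_real (d m) * (of_real (c m) * u m) - of_real (c (Suc m)) * (of_real (d m) * u m))
       = norm (of_real (d m * (c (Suc m) - c m)) * u m)"
      by (subst norm_minus_commute) (simp add: algebra_simps)
    also have "\<dots> = (\<bar>c (Suc m) - c m\<bar> * d m) * norm (u m)"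
      unfolding norm_mult norm_of_real using d(1)[of m] by (simp add: abs_mult)
    also have "\<dots> \<le> (e * D) * norm (u m)"
      using True by (intro mult_right_mono mult_mono lip d e) auto
    finally show ?thesis using True by (simp add: w_def)
  qed (use e D in \<open>simp add: zero\<close>)
  have R: "norm (R m) \<le> e * D * ((case m of 0 \<Rightarrow> 0 | Suc k \<Rightarrow> norm (w k)) + norm (w (Suc m)))" for m
  proof (cases m)
    case 0
    then show ?thesis using up[of 0] by (simp add: R_def jacobi_0)
  next
    case (Suc k)
    let ?A = "of_real (d k) * (of_real (c k) * u k) - of_real (c (Suc k)) * (of_real (d k) * u k)"
    let ?B = "of_real (d m) * (of_real (c (Suc m)) * u (Suc m)) - of_real (c m) * (of_real (d m) * u (Suc m))"
    have "R m = ?A + ?B" by (simp add: R_def jacobi_Suc Suc algebra_simps)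
    then have "norm (R m) \<le> norm ?A + norm ?B" by (simp only: norm_triangle_ineq)
    also have "\<dots> \<le> e * D * norm (w k) + e * D * norm (w (Suc m))"
      by (intro add_mono up down)
    finally show ?thesis by (simp add: Suc algebra_simps)
  qed
  have "ell2_norm w = L2_set (\<lambda>n. norm (w n)) {..N}"
    by (rule ell2_norm_finite_support) (simp add: w_def)
  also have "\<dots> = L2_set (\<lambda>n. norm (u n)) {..N}"
    by (rule L2_set_cong) (auto simp: w_def)
  finally show "R \<in> ell2" "ell2_norm R \<le> 2 * (e * D) * L2_set (\<lambda>n. norm (u n)) {..N}"
    using ell2_norm_neighbour_bound[OF w mult_nonneg_nonneg[OF e D] R] by simp_all
qed

text \<open>A sharp cutoff would leave a commutator of size \<open>d N\<close>. Here the descent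
  from 1 to 0 is spread over the indices from \<open>N\<close> to \<open>2 * N\<close>; truncated
  subtraction keeps the value 0 beyond.\<close>

definition cutoff :: "nat \<Rightarrow> nat \<Rightarrow> real" where
  "cutoff N n = real (min N (2 * N - n)) / real N"

lemma cutoff_eq_1: "0 < N \<Longrightarrow> n \<le> N \<Longrightarrow> cutoff N n = 1"
  and cutoff_eq_0: "2 * N \<le> n \<Longrightarrow> cutoff N n = 0"
  and cutoff_nonneg: "0 \<le> cutoff N n"
  and cutoff_le_1: "cutoff N n \<le> 1"
  by (auto simp: cutoff_def min_def divide_le_eq_1)

lemma cutoff_lipschitz: "\<bar>cutoff N (Suc n) - cutoff N n\<bar> \<le> 1 / real N"
proof -
  have "\<bar>cutoff N (Suc n) - cutoff N n\<bar> = \<bar>real (min N (2 * N - Suc n)) - real (min N (2 * N - n))\<bar> / real N"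
    by (simp add: cutoff_def diff_divide_distrib[symmetric])
  also have "\<dots> \<le> 1 / real N"
    by (intro divide_right_mono) auto
  finally show ?thesis .
qed

text \<open>Green's identity: by symmetry the form \<open>cnj u * jacobi d u\<close>, summed up to
  \<open>N\<close>, is real except for the boundary term at \<open>N\<close>, which
  \<open>u (Suc N) = 0\<close> removes. Comparing imaginary parts and applying Cauchy-Schwarz gives
  the bound.\<close>

lemma truncated_jacobi_bound:
  assumes "u (Suc N) = 0" and f: "\<And>m. m \<le> N \<Longrightarrow> jacobi d u m = f m + z * u m"
  shows "\<bar>Im z\<bar> * L2_set (\<lambda>n. norm (u n)) {..N} \<le> L2_set (\<lambda>n. norm (f n)) {..N}"
proof -
  have tel: "Im (\<Sum>m\<le>M. cnj (u m) * jacobi d u m) = Im (of_real (d M) * cnj (u M) * u (Suc M))" for M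
    by (induction M) (simp_all add: jacobi_0 jacobi_Suc algebra_simps)
  let ?S = "\<Sum>m\<le>N. (norm (u m))\<^sup>2"
  have "(\<Sum>m\<le>N. cnj (u m) * jacobi d u m) = (\<Sum>m\<le>N. cnj (u m) * f m) + z * of_real ?S"
    by (simp add: f sum.distrib sum_distrib_left algebra_simps complex_norm_square del: of_real_power)
  then have "0 = Im (\<Sum>m\<le>N. cnj (u m) * f m) + Im z * ?S"
    using tel[of N] assms(1) by simp
  then have "\<bar>Im z * ?S\<bar> = \<bar>Im (\<Sum>m\<le>N. cnj (u m) * f m)\<bar>" by linarith
  then have "\<bar>Im z\<bar> * ?S = \<bar>Im (\<Sum>m\<le>N. cnj (u m) * f m)\<bar>"
    by (simp only: abs_mult abs_of_nonneg[OF sum_nonneg[OF zero_le_power2]])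
  also have "\<dots> \<le> norm (\<Sum>m\<le>N. cnj (u m) * f m)" by (rule abs_Im_le_cmod)
  also have "\<dots> \<le> (\<Sum>m\<le>N. \<bar>norm (u m)\<bar> * \<bar>norm (f m)\<bar>)"
    by (rule sum_norm_le) (simp add: norm_mult)
  also have "\<dots> \<le> L2_set (\<lambda>n. norm (u n)) {..N} * L2_set (\<lambda>n. norm (f n)) {..N}"
    by (rule L2_set_mult_ineq)
  finally have main: "\<bar>Im z\<bar> * ?S \<le> L2_set (\<lambda>n. norm (u n)) {..N} * L2_set (\<lambda>n. norm (f n)) {..N}" .
  have "?S = L2_set (\<lambda>n. norm (u n)) {..N} * L2_set (\<lambda>n. norm (u n)) {..N}"
    by (simp add: L2_set_def sum_nonneg)
  with main have *: "L2_set (\<lambda>n. norm (u n)) {..N} * (\<bar>Im z\<bar> * L2_set (\<lambda>n. norm (u n)) {..N})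
      \<le> L2_set (\<lambda>n. norm (u n)) {..N} * L2_set (\<lambda>n. norm (f n)) {..N}"
    by (simp add: algebra_simps)
  show ?thesis
  proof (cases "L2_set (\<lambda>n. norm (u n)) {..N} = 0")
    case False
    then have "0 < L2_set (\<lambda>n. norm (u n)) {..N}" using L2_set_nonneg by (simp add: less_le)
    then show ?thesis using * by (simp only: mult_le_cancel_left_pos)
  qed simp
qed

text \<open>Forward substitution in \<open>jacobi d u = f + z * u\<close>: each row determines the
  next entry, and the initial value \<open>t\<close> stays free.\<close>

fun jacobi_sol :: "(nat \<Rightarrow> real) \<Rightarrow> complex \<Rightarrow> (nat \<Rightarrow> complex) \<Rightarrow> complex \<Rightarrow> nat \<Rightarrow> complex" where
  "jacobi_sol d z f t 0 = t"
| "jacobi_sol d z f t (Suc 0) = (f 0 + z * t) / of_real (d 0)"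
| "jacobi_sol d z f t (Suc (Suc m)) =
     (f (Suc m) + z * jacobi_sol d z f t (Suc m) - of_real (d m) * jacobi_sol d z f t m) / of_real (d (Suc m))"

lemma jacobi_jacobi_sol:
  assumes "\<And>m. d m \<noteq> 0"
  shows "jacobi d (jacobi_sol d z f t) m = f m + z * jacobi_sol d z f t m"
  using assms by (cases m) (simp_all add: jacobi_0 jacobi_Suc)

lemma jacobi_sol_affine:
  "jacobi_sol d z f t n = jacobi_sol d z f 0 n + t * jacobi_sol d z (\<lambda>_. 0) 1 n"
  by (induction n rule: induct_nat_012) (simp_all add: field_simps add_divide_distrib diff_divide_distrib)

section \<open>Jacobi operators with off-diagonal entries of square-root growth\<close>

locale sqrt_jacobi =
  fixes d :: "nat \<Rightarrow> real" and c K :: real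
  assumes d_pos: "0 < d m"
    and c_pos: "0 < c"
    and d_lower: "c * (real m + 1) \<le> (d m)\<^sup>2"
    and d_increment: "\<bar>(d (Suc m))\<^sup>2 - (d m)\<^sup>2\<bar> \<le> K"
begin

text \<open>One constant for two purposes: the growth rate of the squares of \<open>d\<close>, and
  the factor in the energy estimate, where \<open>(d 0)\<^sup>2\<close> is the initial energy and
  \<open>K\<close> bounds each increment.\<close>

definition B where "B = (d 0)\<^sup>2 + K"

lemma K_nonneg: "0 \<le> K"
  using d_increment[of 0] by linarith

lemma B_pos: "0 < B"
  using K_nonneg d_pos[of 0] by (simp add: B_def add_pos_nonneg)

lemma d_upper: "(d m)\<^sup>2 \<le> B * (real m + 1)"
proof -
  have "(d m)\<^sup>2 \<le> (d 0)\<^sup>2 + K * real m"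
    by (induction m) (use d_increment in \<open>auto simp: algebra_simps abs_le_iff\<close>, smt (verit))
  also have "\<dots> \<le> B * (real m + 1)"
    using K_nonneg by (simp add: B_def algebra_simps)
  finally show ?thesis .
qed

text \<open>On the support of the cutoff \<open>d m\<close> is at most
  \<open>sqrt (3 * B * N)\<close>, the 3 coming from \<open>2 * N + 1 \<le> 3 * N\<close>.
  Multiplying by the slope \<open>1 / N\<close> leaves \<open>sqrt (3 * B / N)\<close>.\<close>

lemma cutoff_commutator_bound:
  fixes u :: "nat \<Rightarrow> complex"
  assumes "0 < N"
  defines "R \<equiv> \<lambda>m. jacobi d (\<lambda>n. of_real (cutoff N n) * u n) m - of_real (cutoff N m) * jacobi d u m"
  shows "R \<in> ell2"
    and "ell2_norm R \<le> 2 * sqrt (3 * B / N) * L2_set (\<lambda>n. norm (u n)) {..2 * N}"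
proof -
  have D: "d m \<le> sqrt (3 * B * N)" if "m \<le> 2 * N" for m
  proof (rule real_le_rsqrt)
    have "(d m)\<^sup>2 \<le> B * (real m + 1)" by (rule d_upper)
    also have "\<dots> \<le> B * (3 * real N)" using that assms(1) B_pos by (intro mult_left_mono) auto
    finally show "(d m)\<^sup>2 \<le> 3 * B * N" by simp
  qed
  have "1 / real N * sqrt (3 * B * N) = sqrt (3 * B / N)"
    using assms(1) by (simp add: real_sqrt_mult real_sqrt_divide field_simps)
  then show "R \<in> ell2" "ell2_norm R \<le> 2 * sqrt (3 * B / N) * L2_set (\<lambda>n. norm (u n)) {..2 * N}"
    using jacobi_commutator_bound[where d = d and c = "cutoff N" and N = "2 * N" and u = u,
        OF less_imp_le[OF d_pos] D cutoff_lipschitz cutoff_eq_0]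
    unfolding R_def by simp_all
qed

text \<open>The cutoff has slope \<open>1 / N\<close> on a range where \<open>d = O(sqrt N)\<close>, so its commutator with the
  Jacobi operator tends to zero and the minimal and maximal operators coincide.\<close>

lemma closure_graph_jacobi:
  "closure_graph (jacobi d) = {(u, jacobi d u) | u. u \<in> ell2 \<and> jacobi d u \<in> ell2}"
proof (intro equalityI subsetI)
  fix x assume "x \<in> closure_graph (jacobi d)"
  then obtain u v us vs where x: "x = (u, v)" and u: "u \<in> ell2" and v: "v \<in> ell2"
    and g: "\<And>j. (us j, vs j) \<in> finite_graph (jacobi d)"
    and lu: "ell2_tendsto us u" and lv: "ell2_tendsto vs v"
    unfolding closure_graph_def by blast
  have fin: "finite {n. us j n \<noteq> 0}" and vs: "vs j = jacobi d (us j)" for j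
    using g[of j] by (auto simp: finite_graph_def)
  have us2: "us j \<in> ell2" and vs2: "vs j \<in> ell2" for j
    using fin[of j] finite_support_jacobi[OF fin] by (auto simp: vs intro: ell2_finite)
  have "v m = jacobi d u m" for m
  proof (rule LIMSEQ_unique)
    show "(\<lambda>j. vs j m) \<longlonglongrightarrow> v m" by (rule ell2_tendsto_coordinate[OF vs2 v lv])
    show "(\<lambda>j. vs j m) \<longlonglongrightarrow> jacobi d u m"
      unfolding vs using ell2_tendsto_coordinate[OF us2 u lu]
      by (cases m) (auto simp: jacobi_0 jacobi_Suc intro!: tendsto_intros)
  qed
  then have "v = jacobi d u" by auto
  then show "x \<in> {(u, jacobi d u) | u. u \<in> ell2 \<and> jacobi d u \<in> ell2}"
    using x u v by auto
next
  fix x assume "x \<in> {(u, jacobi d u) | u. u \<in> ell2 \<and> jacobi d u \<in> ell2}"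
  then obtain u where x: "x = (u, jacobi d u)" and u: "u \<in> ell2" and v: "jacobi d u \<in> ell2" by auto
  define us where "us j n = of_real (cutoff (Suc j) n) * u n" for j n
  have fin: "finite {n. us j n \<noteq> 0}" for j
  proof (rule finite_subset)
    show "{n. us j n \<noteq> 0} \<subseteq> {..2 * Suc j}"
      by (rule subsetI, rule ccontr) (simp add: us_def cutoff_eq_0)
  qed simp
  have lu: "ell2_tendsto us u"
    unfolding us_def by (rule ell2_tendsto_cutoff[OF u]) (auto simp: cutoff_eq_1 cutoff_nonneg cutoff_le_1)
  \<comment> \<open>The approximation error of the images splits into the commutator
    \<open>R\<close> and, below, the pure cutoff error \<open>Q\<close> of the sequence
    \<open>jacobi d u\<close>, which tends to zero because that sequence lies in
    \<open>ell2\<close>.\<close>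
  define R where "R j m = jacobi d (us j) m - of_real (cutoff (Suc j) m) * jacobi d u m" for j m
  have R: "R j \<in> ell2" "ell2_norm (R j) \<le> 2 * sqrt (3 * B / real (Suc j)) * ell2_norm u" for j
  proof -
    show "R j \<in> ell2"
      using cutoff_commutator_bound(1)[of "Suc j" u] by (simp add: R_def[abs_def] us_def[abs_def])
    have "ell2_norm (R j) \<le> 2 * sqrt (3 * B / real (Suc j)) * L2_set (\<lambda>n. norm (u n)) {..2 * Suc j}"
      using cutoff_commutator_bound(2)[of "Suc j" u] by (simp add: R_def[abs_def] us_def[abs_def])
    also have "\<dots> \<le> 2 * sqrt (3 * B / real (Suc j)) * ell2_norm u"
      using B_pos by (intro mult_left_mono L2_set_le_ell2_norm u) auto
    finally show "ell2_norm (R j) \<le> 2 * sqrt (3 * B / real (Suc j)) * ell2_norm u" .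
  qed
  define Q where "Q j m = of_real (cutoff (Suc j) m) * jacobi d u m - jacobi d u m" for j m
  have Q0: "(\<lambda>j. ell2_norm (Q j)) \<longlonglongrightarrow> 0"
    using ell2_tendsto_cutoff[OF v, of "\<lambda>j. cutoff (Suc j)"]
    by (auto simp: ell2_tendsto_def Q_def[abs_def] cutoff_eq_1 cutoff_nonneg cutoff_le_1)
  have us2: "us j \<in> ell2" for j by (rule ell2_finite[OF fin])
  have vs2: "jacobi d (us j) \<in> ell2" for j by (rule ell2_finite[OF finite_support_jacobi[OF fin]])
  have eq: "jacobi d (us j) m - jacobi d u m = R j m + Q j m" for j m
    by (simp add: R_def Q_def)
  have Q2: "Q j \<in> ell2" for j
    using ell2_diff(1)[OF ell2_diff(1)[OF vs2[of j] v] R(1)[of j]] eq[of j] by simp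
  have le: "ell2_norm (\<lambda>m. jacobi d (us j) m - jacobi d u m)
      \<le> 2 * sqrt (3 * B / real (Suc j)) * ell2_norm u + ell2_norm (Q j)" for j
    unfolding eq using ell2_add(2)[OF R(1) Q2, of j j] R(2)[of j] by linarith
  have "(\<lambda>j. 3 * B / real (Suc j)) \<longlonglongrightarrow> 0"
    using LIMSEQ_Suc[OF lim_const_over_n[of "3 * B"]] .
  then have "(\<lambda>j. 2 * sqrt (3 * B / real (Suc j)) * ell2_norm u + ell2_norm (Q j))
      \<longlonglongrightarrow> 2 * sqrt 0 * ell2_norm u + 0"
    by (intro tendsto_intros Q0)
  then have lim: "(\<lambda>j. 2 * sqrt (3 * B / real (Suc j)) * ell2_norm u + ell2_norm (Q j)) \<longlonglongrightarrow> 0" by simp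
  have lv: "ell2_tendsto (\<lambda>j. jacobi d (us j)) (jacobi d u)"
    unfolding ell2_tendsto_def
    by (rule tendsto_sandwich[OF _ _ tendsto_const lim])
      (intro always_eventually allI le ell2_norm_nonneg ell2_diff vs2 v)+
  have "\<forall>j. (us j, jacobi d (us j)) \<in> finite_graph (jacobi d)"
    using fin by (auto simp: finite_graph_def)
  with lu lv have "\<exists>us vs. (\<forall>j. (us j, vs j) \<in> finite_graph (jacobi d))
      \<and> ell2_tendsto us u \<and> ell2_tendsto vs (jacobi d u)"
    by (intro exI conjI)
  with u v show "x \<in> closure_graph (jacobi d)"
    by (simp add: x closure_graph_def)
qed

text \<open>For general \<open>u\<close> the boundary term in Green's identity need not vanish at
  any \<open>N\<close>. It does for finitely supported approximants, and those converge together
  with their images because the maximal graph is the closure.\<close>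

lemma jacobi_bounded_below:
  assumes u: "u \<in> ell2" "jacobi d u \<in> ell2"
  shows "\<bar>Im z\<bar> * ell2_norm u \<le> ell2_norm (\<lambda>n. jacobi d u n - z * u n)"
proof -
  have "(u, jacobi d u) \<in> closure_graph (jacobi d)" using u closure_graph_jacobi by auto
  then obtain us vs where g: "\<And>j. (us j, vs j) \<in> finite_graph (jacobi d)"
    and lu: "ell2_tendsto us u" and lv: "ell2_tendsto vs (jacobi d u)"
    unfolding closure_graph_def by blast
  have fin: "finite {n. us j n \<noteq> 0}" and vs: "vs j = jacobi d (us j)" for j
    using g[of j] by (auto simp: finite_graph_def)
  have us2: "us j \<in> ell2" and vs2: "vs j \<in> ell2" for j
    using fin[of j] finite_support_jacobi[OF fin] by (auto simp: vs intro: ell2_finite)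
  have le: "\<bar>Im z\<bar> * ell2_norm (us j) \<le> ell2_norm (\<lambda>n. vs j n - z * us j n)" for j
  proof -
    obtain N where N: "\<And>n. us j n \<noteq> 0 \<Longrightarrow> n \<le> N"
      using fin[of j] unfolding finite_nat_set_iff_bounded_le by blast
    have "ell2_norm (us j) = L2_set (\<lambda>n. norm (us j n)) {..N}"
      by (rule ell2_norm_finite_support) (use N not_le in blast)
    then have "\<bar>Im z\<bar> * ell2_norm (us j) = \<bar>Im z\<bar> * L2_set (\<lambda>n. norm (us j n)) {..N}" by simp
    also have "\<dots> \<le> L2_set (\<lambda>n. norm (vs j n - z * us j n)) {..N}"
      by (rule truncated_jacobi_bound[where d = d]) (use N[of "Suc N"] in \<open>auto simp: vs\<close>)
    also have "\<dots> \<le> ell2_norm (\<lambda>n. vs j n - z * us j n)"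
      by (intro L2_set_le_ell2_norm ell2_diff ell2_cmult us2 vs2) auto
    finally show ?thesis .
  qed
  show ?thesis
  proof (rule LIMSEQ_le)
    show "(\<lambda>j. \<bar>Im z\<bar> * ell2_norm (us j)) \<longlonglongrightarrow> \<bar>Im z\<bar> * ell2_norm u"
      by (intro tendsto_intros ell2_norm_tendsto us2 u lu)
    show "(\<lambda>j. ell2_norm (\<lambda>n. vs j n - z * us j n)) \<longlonglongrightarrow> ell2_norm (\<lambda>n. jacobi d u n - z * u n)"
      by (intro ell2_norm_tendsto ell2_diff ell2_cmult ell2_tendsto_diff us2 vs2 u lu lv)
  qed (use le in auto)
qed

text \<open>The formal solutions form an affine line in the initial value.  Those with
  \<open>u (Suc N) = 0\<close> have uniformly bounded truncations, and a limit point of their initial values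
  gives a square-summable solution.\<close>

lemma jacobi_surj:
  assumes z: "Im z \<noteq> 0" and f: "f \<in> ell2"
  shows "\<exists>u\<in>ell2. \<forall>m. jacobi d u m = f m + z * u m"
proof -
  have d0: "d m \<noteq> 0" for m using d_pos[of m] by simp
  define \<phi> where "\<phi> = jacobi_sol d z (\<lambda>_. 0) 1"
  define S where "S t = jacobi_sol d z f t" for t
  have S_aff: "S t n = S 0 n + t * \<phi> n" for t n
    unfolding S_def \<phi>_def by (rule jacobi_sol_affine)
  \<comment> \<open>A zero at \<open>Suc N\<close> would make the non-real \<open>z\<close> an
    eigenvalue of a truncated Hermitian matrix.\<close>
  have \<phi>0: "\<phi> (Suc N) \<noteq> 0" for N
  proof
    assume "\<phi> (Suc N) = 0"
    then have "\<bar>Im z\<bar> * L2_set (\<lambda>n. norm (\<phi> n)) {..N} \<le> L2_set (\<lambda>n. norm ((\<lambda>_. 0::complex) n)) {..N}"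
      by (rule truncated_jacobi_bound[where d = d]) (simp add: \<phi>_def jacobi_jacobi_sol d0)
    then have "L2_set (\<lambda>n. norm (\<phi> n)) {..N} \<le> 0"
      using z by (simp add: L2_set_def mult_le_0_iff)
    moreover have "norm (\<phi> 0) \<le> L2_set (\<lambda>n. norm (\<phi> n)) {..N}"
      by (rule member_le_L2_set) auto
    ultimately show False by (simp add: \<phi>_def)
  qed
  \<comment> \<open>The root in \<open>t\<close> of \<open>S 0 (Suc N) + t * \<phi> (Suc N)\<close>,
    so that the boundary condition of the truncated bound holds.\<close>
  define t where "t N = - S 0 (Suc N) / \<phi> (Suc N)" for N
  have vanish: "S (t N) (Suc N) = 0" for N
    using \<phi>0[of N] by (subst S_aff) (simp add: t_def)
  define r where "r = ell2_norm f / \<bar>Im z\<bar>"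
  have bd: "L2_set (\<lambda>n. norm (S (t N) n)) {..M} \<le> r" if "M \<le> N" for M N
  proof -
    have "\<bar>Im z\<bar> * L2_set (\<lambda>n. norm (S (t N) n)) {..N} \<le> L2_set (\<lambda>n. norm (f n)) {..N}"
      by (rule truncated_jacobi_bound[where d = d]) (auto simp: vanish, simp add: S_def jacobi_jacobi_sol d0)
    also have "\<dots> \<le> ell2_norm f" by (rule L2_set_le_ell2_norm[OF f]) simp
    finally have "L2_set (\<lambda>n. norm (S (t N) n)) {..N} \<le> r"
      using z by (simp add: r_def field_simps)
    moreover have "L2_set (\<lambda>n. norm (S (t N) n)) {..M} \<le> L2_set (\<lambda>n. norm (S (t N) n)) {..N}"
      unfolding L2_set_def using that by (intro real_sqrt_le_mono sum_mono2) auto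
    ultimately show ?thesis by simp
  qed
  \<comment> \<open>The entry of \<open>S (t N)\<close> at index 0 is \<open>t N\<close> itself, so
    the shortest truncation already bounds the initial values.\<close>
  have "norm (t N) \<le> r" for N
    using bd[of 0 N] by (simp add: S_def L2_set_def)
  then have "bounded (range t)" by (auto simp: bounded_iff)
  then obtain l s where s: "strict_mono s" and l: "(t \<circ> s) \<longlonglongrightarrow> l"
    using bounded_imp_convergent_subsequence[of t] by metis
  have lim: "(\<lambda>j. S (t (s j)) n) \<longlonglongrightarrow> S l n" for n
  proof -
    have "(\<lambda>j. S 0 n + t (s j) * \<phi> n) \<longlonglongrightarrow> S 0 n + l * \<phi> n"
      using l unfolding comp_def by (intro tendsto_intros)
    then show ?thesis by (simp only: S_aff[symmetric])
  qed
  have "L2_set (\<lambda>n. norm (S l n)) {..M} \<le> r" for M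
  proof (rule LIMSEQ_le_const2)
    show "(\<lambda>j. L2_set (\<lambda>n. norm (S (t (s j)) n)) {..M}) \<longlonglongrightarrow> L2_set (\<lambda>n. norm (S l n)) {..M}"
      unfolding L2_set_def by (intro tendsto_intros lim)
    show "\<exists>N. \<forall>j\<ge>N. L2_set (\<lambda>n. norm (S (t (s j)) n)) {..M} \<le> r"
      by (intro exI[of _ M] allI impI bd) (rule order_trans[OF _ seq_suble[OF s]])
  qed
  then have "S l \<in> ell2" by (rule ell2_bounded_partial)
  then show ?thesis
    by (intro bexI[of _ "S l"]) (simp_all add: S_def jacobi_jacobi_sol d0)
qed

text \<open>Existence comes from \<open>jacobi_surj\<close>; the lower bound by
  \<open>\<bar>Im z\<bar>\<close> yields both uniqueness and the bounded inverse.\<close>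

lemma nonreal_in_resolvent_set:
  assumes z: "Im z \<noteq> 0"
  shows "z \<in> resolvent_set (closure_graph (jacobi d))"
proof -
  have bound: "ell2_norm u \<le> (1 / \<bar>Im z\<bar>) * ell2_norm (\<lambda>n. jacobi d u n - z * u n)"
    if "u \<in> ell2" "jacobi d u \<in> ell2" for u
    using jacobi_bounded_below[OF that, of z] z by (simp add: field_simps)
  have ex1: "\<exists>!u. \<exists>v. (u, v) \<in> closure_graph (jacobi d) \<and> (\<lambda>n. v n - z * u n) = f" if f: "f \<in> ell2" for f
  proof -
    obtain u where u: "u \<in> ell2" and eq: "\<And>m. jacobi d u m = f m + z * u m"
      using jacobi_surj[OF z f] by blast
    have v: "jacobi d u \<in> ell2"
      using ell2_add(1)[OF f ell2_cmult[OF u, of z]] eq by (metis (no_types, lifting) ext)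
    show ?thesis
    proof (rule ex1I[of _ u])
      show "\<exists>v. (u, v) \<in> closure_graph (jacobi d) \<and> (\<lambda>n. v n - z * u n) = f"
        unfolding closure_graph_jacobi using u v eq by auto
    next
      fix u' assume "\<exists>v. (u', v) \<in> closure_graph (jacobi d) \<and> (\<lambda>n. v n - z * u' n) = f"
      then have u': "u' \<in> ell2" "jacobi d u' \<in> ell2" and f': "(\<lambda>n. jacobi d u' n - z * u' n) = f"
        unfolding closure_graph_jacobi by auto
      define w where "w n = u' n - u n" for n
      have jw: "jacobi d w n = jacobi d u' n - jacobi d u n" for n
        unfolding w_def by (rule jacobi_diff)
      have w: "w \<in> ell2" "jacobi d w \<in> ell2"
        using ell2_diff(1)[OF u'(1) u] ell2_diff(1)[OF u'(2) v]
        by (simp_all add: w_def[abs_def] flip: jw)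
      have "jacobi d w n - z * w n = 0" for n
        using fun_cong[OF f', of n] eq[of n] by (simp add: jw w_def algebra_simps)
      then have "ell2_norm w \<le> 0" using bound[OF w] by (simp add: ell2_norm_def)
      then have "w n = 0" for n using norm_le_ell2_norm[OF w(1), of n] by (metis norm_le_zero_iff order_trans)
      then show "u' = u" by (auto simp: w_def)
    qed
  qed
  have "\<exists>C. \<forall>(u, v)\<in>closure_graph (jacobi d). ell2_norm u \<le> C * ell2_norm (\<lambda>n. v n - z * u n)"
    using bound unfolding closure_graph_jacobi by (intro exI[of _ "1 / \<bar>Im z\<bar>"]) auto
  then show ?thesis using ex1 unfolding resolvent_set_def by blast
qed

section \<open>Growth of formal solutions at a real spectral parameter\<close>

context
  fixes x :: "nat \<Rightarrow> real" and l :: real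
  assumes x0: "x 0 = 1" and rec0: "d 0 * x (Suc 0) = l * x 0"
    and rec: "d m * x m + d (Suc m) * x (Suc (Suc m)) = l * x (Suc m)"
begin

text \<open>For constant \<open>d\<close> this is the quadratic form in two consecutive entries that
  the transfer matrix preserves. By the recurrence it equals
  \<open>(d m * x m)^2 - d m * d (m - 1) * x (m - 1) * x (Suc m)\<close> for positive
  \<open>m\<close>, a weighted Turan determinant.\<close>

definition energy where
  "energy m = (d m)\<^sup>2 * ((x m)\<^sup>2 + (x (Suc m))\<^sup>2) - l * d m * x m * x (Suc m)"

text \<open>The remaining difference factors like a difference of squares, with the recurrence as
  one factor.\<close>

lemma energy_Suc: "energy (Suc m) = energy m + ((d (Suc m))\<^sup>2 - (d m)\<^sup>2) * (x (Suc m))\<^sup>2"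
proof -
  have "energy (Suc m) - energy m - ((d (Suc m))\<^sup>2 - (d m)\<^sup>2) * (x (Suc m))\<^sup>2
     = (d (Suc m) * x (Suc (Suc m)) - d m * x m) * (d m * x m + d (Suc m) * x (Suc (Suc m)) - l * x (Suc m))"
    by (simp add: energy_def power2_eq_square algebra_simps)
  then show ?thesis using rec[of m] by simp
qed

lemma energy_le: "energy m \<le> B * (\<Sum>k\<le>m. (x k)\<^sup>2)"
proof (induction m)
  case 0
  have "energy 0 = (d 0 * x 0)\<^sup>2 + d 0 * x (Suc 0) * (d 0 * x (Suc 0) - l * x 0)"
    by (simp add: energy_def power2_eq_square algebra_simps)
  then show ?case using rec0 K_nonneg x0 by (simp add: B_def)
next
  case (Suc m)
  have "((d (Suc m))\<^sup>2 - (d m)\<^sup>2) * (x (Suc m))\<^sup>2 \<le> B * (x (Suc m))\<^sup>2"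
    using d_increment[of m] zero_le_power2[of "d 0"]
    unfolding B_def by (intro mult_right_mono zero_le_power2) linarith
  then show ?case using Suc by (simp add: energy_Suc algebra_simps)
qed

text \<open>Once \<open>\<bar>l\<bar> \<le> d m\<close>, the cross term takes at most half of the
  squares by the arithmetic-geometric mean inequality, so the form is coercive.\<close>

lemma energy_ge:
  assumes "\<bar>l\<bar> \<le> d m" shows "(d m)\<^sup>2 * (x (Suc m))\<^sup>2 \<le> 2 * energy m"
proof -
  have "2 * (l * d m * x m * x (Suc m)) \<le> 2 * (\<bar>l\<bar> * d m * \<bar>x m * x (Suc m)\<bar>)"
    using d_pos[of m] by (simp add: abs_mult flip: mult.assoc) (metis abs_ge_self abs_mult)
  also have "\<dots> \<le> d m * d m * (2 * \<bar>x m * x (Suc m)\<bar>)"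
    using assms d_pos[of m] by (simp add: mult_right_mono mult.assoc mult_left_mono)
  also have "\<dots> \<le> d m * d m * ((x m)\<^sup>2 + (x (Suc m))\<^sup>2)"
    using sum_squares_bound[of "\<bar>x m\<bar>" "\<bar>x (Suc m)\<bar>"] by (intro mult_left_mono) (auto simp: abs_mult)
  finally have "2 * (l * d m * x m * x (Suc m)) \<le> (d m)\<^sup>2 * ((x m)\<^sup>2 + (x (Suc m))\<^sup>2)"
    by (simp add: power2_eq_square)
  moreover have "2 * energy m = 2 * ((d m)\<^sup>2 * ((x m)\<^sup>2 + (x (Suc m))\<^sup>2)) - 2 * (l * d m * x m * x (Suc m))"
    by (simp add: energy_def)
  moreover have "(d m)\<^sup>2 * ((x m)\<^sup>2 + (x (Suc m))\<^sup>2) = (d m)\<^sup>2 * (x m)\<^sup>2 + (d m)\<^sup>2 * (x (Suc m))\<^sup>2"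
    by (rule distrib_left)
  moreover have "0 \<le> (d m)\<^sup>2 * (x m)\<^sup>2" by simp
  ultimately show ?thesis by linarith
qed

text \<open>The Gronwall step: the new square is controlled by the energy, and the energy by the sum
  so far. The condition on \<open>M\<close> yields \<open>\<bar>l\<bar> \<le> d m\<close> through
  \<open>d_lower\<close>.\<close>

lemma partial_sum_Suc_le:
  assumes "l\<^sup>2 / c \<le> real M" "0 < M" "M \<le> m"
  shows "(\<Sum>k\<le>Suc m. (x k)\<^sup>2) \<le> (1 + 2 * B / c / real M) * (\<Sum>k\<le>m. (x k)\<^sup>2)"
proof -
  let ?S = "\<Sum>k\<le>m. (x k)\<^sup>2"
  have cM: "c * real M \<le> (d m)\<^sup>2"
    using assms c_pos d_lower[of m] by (smt (verit) mult_left_mono of_nat_mono)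
  then have "l\<^sup>2 \<le> (d m)\<^sup>2" using assms(1) c_pos by (simp add: field_simps)
  then have "\<bar>l\<bar> \<le> d m" using d_pos[of m] by (simp add: abs_le_square_iff[symmetric])
  then have "(d m)\<^sup>2 * (x (Suc m))\<^sup>2 \<le> 2 * (B * ?S)"
    using energy_ge[of m] energy_le[of m] by linarith
  moreover have "c * real M * (x (Suc m))\<^sup>2 \<le> (d m)\<^sup>2 * (x (Suc m))\<^sup>2"
    using cM by (rule mult_right_mono) simp
  ultimately have "c * real M * (x (Suc m))\<^sup>2 \<le> 2 * (B * ?S)" by linarith
  then have "(x (Suc m))\<^sup>2 \<le> 2 * B / c / real M * ?S"
    using c_pos assms(2) by (simp add: field_simps)
  then show ?thesis by (simp add: algebra_simps)
qed

text \<open>Going from \<open>M\<close> to \<open>2 * M\<close> takes \<open>M\<close> steps, each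
  costing a factor \<open>1 + (2 * B / c) / M\<close>; the product stays below an exponential
  independent of \<open>M\<close>.\<close>

lemma partial_sum_doubling:
  assumes "l\<^sup>2 / c \<le> real M" "0 < M"
  shows "(\<Sum>k\<le>2 * M. (x k)\<^sup>2) \<le> exp (2 * B / c) * (\<Sum>k\<le>M. (x k)\<^sup>2)"
proof -
  let ?q = "1 + 2 * B / c / real M"
  have q: "0 \<le> ?q" using B_pos c_pos by simp
  have "(\<Sum>k\<le>M + j. (x k)\<^sup>2) \<le> ?q ^ j * (\<Sum>k\<le>M. (x k)\<^sup>2)" for j
  proof (induction j)
    case (Suc j)
    have "(\<Sum>k\<le>M + Suc j. (x k)\<^sup>2) \<le> ?q * (\<Sum>k\<le>M + j. (x k)\<^sup>2)"
      using partial_sum_Suc_le[OF assms, of "M + j"] by simp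
    also have "\<dots> \<le> ?q * (?q ^ j * (\<Sum>k\<le>M. (x k)\<^sup>2))"
      by (intro mult_left_mono Suc q)
    finally show ?case by (simp add: mult.assoc)
  qed simp
  from this[of M] have "(\<Sum>k\<le>2 * M. (x k)\<^sup>2) \<le> ?q ^ M * (\<Sum>k\<le>M. (x k)\<^sup>2)"
    by (simp only: mult_2)
  also have "?q ^ M \<le> exp (2 * B / c / real M) ^ M"
    using q by (intro power_mono exp_ge_add_one_self)
  also have "exp (2 * B / c / real M) ^ M = exp (2 * B / c)"
    using assms(2) by (simp flip: exp_of_nat_mult)
  finally show ?thesis by (simp add: sum_nonneg mult_right_mono)
qed

end

lemma real_notin_resolvent_set:
  "complex_of_real l \<notin> resolvent_set (closure_graph (jacobi d))"
proof
  assume "complex_of_real l \<in> resolvent_set (closure_graph (jacobi d))"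
  then obtain C where C: "\<And>u v. (u, v) \<in> closure_graph (jacobi d) \<Longrightarrow>
      ell2_norm u \<le> C * ell2_norm (\<lambda>n. v n - complex_of_real l * u n)"
    unfolding resolvent_set_def by blast
  have d0: "d m \<noteq> 0" for m using d_pos[of m] by simp
  \<comment> \<open>The energy estimates concern real sequences; as \<open>d\<close> and
    \<open>l\<close> are real, real parts obey the same recurrence.\<close>
  define x where "x n = Re (jacobi_sol d (of_real l) (\<lambda>_. 0) 1 n)" for n
  have x0: "x 0 = 1" by (simp add: x_def)
  have rec0: "d 0 * x (Suc 0) = l * x 0"
    by (simp add: x_def d0)
  have rec: "d m * x m + d (Suc m) * x (Suc (Suc m)) = l * x (Suc m)" for m
    by (simp add: x_def d0)
  define u :: "nat \<Rightarrow> complex" where "u n = of_real (x n)" for n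
  have ju: "jacobi d u m = of_real l * u m" for m
    using rec0 rec by (cases m) (simp_all add: jacobi_0 jacobi_Suc u_def flip: of_real_mult of_real_add)
  let ?S = "\<lambda>M. \<Sum>k\<le>M. (x k)\<^sup>2"
  have L2: "L2_set (\<lambda>n. norm (u n)) {..M} = sqrt (?S M)" for M
    by (simp add: L2_set_def u_def)
  \<comment> \<open>The first threshold makes the doubling bound available; the second is the value
    that a resolvent bound with constant \<open>C\<close> would force \<open>M\<close> not to
    exceed.\<close>
  obtain M0 :: nat where M0: "max (l\<^sup>2 / c) (C\<^sup>2 * (4 * (3 * B) * exp (2 * B / c))) < real M0"
    using reals_Archimedean2 by blast
  define M where "M = Suc M0"
  have M: "l\<^sup>2 / c \<le> real M" "C\<^sup>2 * (4 * (3 * B) * exp (2 * B / c)) < real M" "0 < M"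
    using M0 by (auto simp: M_def)
  define w where "w n = of_real (cutoff M n) * u n" for n
  have fin: "finite {n. w n \<noteq> 0}"
  proof (rule finite_subset)
    show "{n. w n \<noteq> 0} \<subseteq> {..2 * M}"
      by (rule subsetI, rule ccontr) (simp add: w_def cutoff_eq_0)
  qed simp
  have w2: "w \<in> ell2" "jacobi d w \<in> ell2"
    using fin finite_support_jacobi[OF fin] by (auto intro: ell2_finite)
  have "(w, jacobi d w) \<in> closure_graph (jacobi d)"
    using w2 closure_graph_jacobi by auto
  note C[OF this]
  also have "C * ell2_norm (\<lambda>n. jacobi d w n - complex_of_real l * w n)
      \<le> \<bar>C\<bar> * ell2_norm (\<lambda>n. jacobi d w n - complex_of_real l * w n)"
    by (intro mult_right_mono ell2_norm_nonneg ell2_diff ell2_cmult w2) auto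
  \<comment> \<open>Since \<open>jacobi d u\<close> is \<open>l\<close> times \<open>u\<close>, the
    residual of \<open>w\<close> is exactly the cutoff commutator applied to
    \<open>u\<close>.\<close>
  also have "\<dots> \<le> \<bar>C\<bar> * (2 * sqrt (3 * B / M) * sqrt (?S (2 * M)))"
    using cutoff_commutator_bound(2)[OF M(3), of u]
    by (intro mult_left_mono) (simp_all add: ju L2 w_def[abs_def] mult.left_commute)
  also have "\<dots> \<le> \<bar>C\<bar> * (2 * sqrt (3 * B / M) * sqrt (exp (2 * B / c) * ?S M))"
    using partial_sum_doubling[OF x0 rec0 rec M(1,3)] B_pos
    by (intro mult_left_mono) auto
  finally have up: "ell2_norm w \<le> \<bar>C\<bar> * (2 * sqrt (3 * B / M) * sqrt (exp (2 * B / c) * ?S M))" .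
  have "sqrt (?S M) = L2_set (\<lambda>n. norm (w n)) {..M}"
    unfolding L2[symmetric] by (rule L2_set_cong) (auto simp: w_def cutoff_eq_1 M)
  also have "\<dots> \<le> ell2_norm w" by (rule L2_set_le_ell2_norm[OF w2(1)]) simp
  also note up
  finally have "(sqrt (?S M))\<^sup>2 \<le> (\<bar>C\<bar> * (2 * sqrt (3 * B / M) * sqrt (exp (2 * B / c) * ?S M)))\<^sup>2"
    by (rule power_mono) (simp add: sum_nonneg)
  then have le: "?S M \<le> C\<^sup>2 * (4 * (3 * B / M) * (exp (2 * B / c) * ?S M))"
    using B_pos by (simp add: power_mult_distrib sum_nonneg)
  have "(x 0)\<^sup>2 \<le> ?S M" by (rule member_le_sum) auto
  then have S: "0 < ?S M" using x0 by simp
  have "?S M * real M \<le> (C\<^sup>2 * (4 * (3 * B) * exp (2 * B / c))) * ?S M"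
    using mult_right_mono[OF le, of "real M"] M(3) by (simp add: field_simps)
  then have "real M \<le> C\<^sup>2 * (4 * (3 * B) * exp (2 * B / c))"
    using S by (simp only: mult.commute[of "?S M"] mult_le_cancel_right_pos)
  with M(2) show False by simp
qed

lemma spectrum_jacobi: "op_spectrum (closure_graph (jacobi d)) = \<real>"
proof -
  have "z \<in> resolvent_set (closure_graph (jacobi d)) \<longleftrightarrow> Im z \<noteq> 0" for z
    using nonreal_in_resolvent_set[of z] real_notin_resolvent_set[of "Re z"]
    by (metis complex_is_Real_iff of_real_Re)
  then have "resolvent_set (closure_graph (jacobi d)) = - \<real>"
    by (intro set_eqI) (simp only: Compl_iff complex_is_Real_iff)
  then show ?thesis by (simp add: op_spectrum_def)
qed

end


section \<open>The position and momentum operators\<close>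

lemma unit_mult_cancel:
  fixes s x :: complex
  assumes "norm s = 1" shows "s * (cnj s * x) = x" and "cnj s * (s * x) = x"
proof -
  have s: "s * cnj s = 1" using complex_norm_square[of s] assms by simp
  then have s': "cnj s * s = 1" by (simp only: mult.commute)
  show "s * (cnj s * x) = x" "cnj s * (s * x) = x" by (simp_all only: mult.assoc[symmetric] s s' mult_1_left)
qed

lemma closure_graph_twist:
  assumes s: "\<And>n. norm (s n) = 1" and T': "\<And>v. T' (\<lambda>n. s n * v n) = (\<lambda>n. s n * T v n)"
    and uv: "(u, v) \<in> closure_graph T"
  shows "((\<lambda>n. s n * u n), (\<lambda>n. s n * v n)) \<in> closure_graph T'"
proof -
  obtain us vs where g: "\<And>j. (us j, vs j) \<in> finite_graph T"
    and lu: "ell2_tendsto us u" and lv: "ell2_tendsto vs v" and u: "u \<in> ell2" and v: "v \<in> ell2"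
    using uv unfolding closure_graph_def by blast
  have nz: "s n \<noteq> 0" for n using s[of n] by auto
  have lim: "ell2_tendsto (\<lambda>j n. s n * us j n) (\<lambda>n. s n * u n)" if "ell2_tendsto us u" for us u
    using that by (simp add: ell2_tendsto_def ell2_norm_def norm_mult s flip: right_diff_distrib)
  have "((\<lambda>n. s n * us j n), (\<lambda>n. s n * vs j n)) \<in> finite_graph T'" for j
    using g[of j] nz by (auto simp: finite_graph_def T')
  moreover have "(\<lambda>n. s n * u n) \<in> ell2" "(\<lambda>n. s n * v n) \<in> ell2"
    using u v by (simp_all add: ell2_def norm_mult s)
  moreover note lim[OF lu] lim[OF lv]
  ultimately show ?thesis
    unfolding closure_graph_def mem_Collect_eq case_prod_conv by (intro conjI exI allI)
qed

text \<open>One inclusion suffices: the intertwining relation is symmetric under exchanging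
  \<open>T\<close> with \<open>T'\<close> and \<open>s\<close> with its conjugate, which gives the
  converse.\<close>

lemma resolvent_set_twist_subset:
  assumes s: "\<And>n. norm (s n) = 1" and T': "\<And>v. T' (\<lambda>n. s n * v n) = (\<lambda>n. s n * T v n)"
  shows "resolvent_set (closure_graph T) \<subseteq> resolvent_set (closure_graph T')"
proof
  fix z assume z: "z \<in> resolvent_set (closure_graph T)"
  then have ex1: "\<exists>!u. \<exists>v. (u, v) \<in> closure_graph T \<and> (\<lambda>n. v n - z * u n) = f" if "f \<in> ell2" for f
    using that by (simp add: resolvent_set_def)
  from z have "\<exists>C. \<forall>(u, v)\<in>closure_graph T. ell2_norm u \<le> C * ell2_norm (\<lambda>n. v n - z * u n)"
    by (simp add: resolvent_set_def)
  then obtain C where "\<forall>(u, v)\<in>closure_graph T. ell2_norm u \<le> C * ell2_norm (\<lambda>n. v n - z * u n)" ..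
  then have C: "ell2_norm u \<le> C * ell2_norm (\<lambda>n. v n - z * u n)" if "(u, v) \<in> closure_graph T" for u v
    using that by auto
  have inv: "s n * (cnj (s n) * x) = x" "cnj (s n) * (s n * x) = x" for n x
    using unit_mult_cancel[OF s[of n]] by simp_all
  have cs: "norm (cnj (s n)) = 1" for n using s by simp
  have T: "T (\<lambda>n. cnj (s n) * v n) = (\<lambda>n. cnj (s n) * T' v n)" for v
    using T'[of "\<lambda>n. cnj (s n) * v n"] by (simp add: inv)
  note untwist = closure_graph_twist[of "\<lambda>n. cnj (s n)" T T', OF cs T]
  have norm_cs: "ell2_norm (\<lambda>n. cnj (s n) * u n) = ell2_norm u" for u
    by (simp add: ell2_norm_def norm_mult s)
  have diff: "(\<lambda>n. cnj (s n) * v n - z * (cnj (s n) * u n)) = (\<lambda>n. cnj (s n) * (v n - z * u n))" for u v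
    by (simp add: algebra_simps)
  have ex1': "\<exists>!u. \<exists>v. (u, v) \<in> closure_graph T' \<and> (\<lambda>n. v n - z * u n) = f" if f: "f \<in> ell2" for f
  proof -
    have "(\<lambda>n. cnj (s n) * f n) \<in> ell2" using f by (simp add: ell2_def norm_mult s)
    note e = ex1[OF this]
    from e obtain u v where uv: "(u, v) \<in> closure_graph T" and fu: "(\<lambda>n. v n - z * u n) = (\<lambda>n. cnj (s n) * f n)"
      by blast
    show ?thesis
    proof (rule ex1I[of _ "\<lambda>n. s n * u n"])
      have "s n * v n - z * (s n * u n) = f n" for n
      proof -
        have "s n * (v n - z * u n) = f n"
          by (simp only: fun_cong[OF fu] inv)
        then show ?thesis by (simp add: algebra_simps)
      qed
      then show "\<exists>v. ((\<lambda>n. s n * u n), v) \<in> closure_graph T' \<and> (\<lambda>n. v n - z * (s n * u n)) = f"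
        using closure_graph_twist[OF s T' uv] by (intro exI[of _ "\<lambda>n. s n * v n"]) simp
    next
      fix w assume "\<exists>v. (w, v) \<in> closure_graph T' \<and> (\<lambda>n. v n - z * w n) = f"
      then obtain y where wy: "(w, y) \<in> closure_graph T'" and fw: "(\<lambda>n. y n - z * w n) = f" by blast
      have "(\<lambda>n. cnj (s n) * y n - z * (cnj (s n) * w n)) = (\<lambda>n. cnj (s n) * f n)"
        unfolding diff using fw by (metis (no_types))
      then have "(\<lambda>n. cnj (s n) * w n) = u"
        using e uv fu untwist[OF wy] by blast
      then show "w = (\<lambda>n. s n * u n)" by (auto simp: inv)
    qed
  qed
  have "ell2_norm u \<le> C * ell2_norm (\<lambda>n. v n - z * u n)" if "(u, v) \<in> closure_graph T'" for u v
    using C[OF untwist[OF that]] by (simp only: diff norm_cs)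
  then show "z \<in> resolvent_set (closure_graph T')"
    using ex1' unfolding resolvent_set_def by blast
qed

lemma op_spectrum_twist:
  assumes s: "\<And>n. norm (s n) = 1" and T': "\<And>v. T' (\<lambda>n. s n * v n) = (\<lambda>n. s n * T v n)"
  shows "op_spectrum (closure_graph T') = op_spectrum (closure_graph T)"
proof -
  have inv: "s n * (cnj (s n) * x) = x" "cnj (s n) * (s n * x) = x" for n x
    using unit_mult_cancel[OF s[of n]] by simp_all
  have T: "T (\<lambda>n. cnj (s n) * v n) = (\<lambda>n. cnj (s n) * T' v n)" for v
    using T'[of "\<lambda>n. cnj (s n) * v n"] by (simp add: inv)
  have "resolvent_set (closure_graph T) = resolvent_set (closure_graph T')"
    using resolvent_set_twist_subset[of s T' T, OF s T']
      resolvent_set_twist_subset[of "\<lambda>n. cnj (s n)" T T', OF _ T] s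
    by (intro equalityI) simp_all
  then show ?thesis by (simp add: op_spectrum_def)
qed

section \<open>Matrix entries of the position and momentum operators\<close>

definition osp_coeff :: "real \<Rightarrow> nat \<Rightarrow> real" where
  "osp_coeff a k = (if even k then sqrt (real (k div 2) + a) else sqrt (real (k div 2) + 1))"

lemma osp_coeff_even: "osp_coeff a (2 * n) = sqrt (real n + a)"
  and osp_coeff_odd: "osp_coeff a (Suc (2 * n)) = sqrt (real n + 1)"
  by (simp_all add: osp_coeff_def)

lemma osp_coeff_pos: "0 < a \<Longrightarrow> 0 < osp_coeff a k"
  by (simp add: osp_coeff_def add_nonneg_pos)

text \<open>The squared entries are \<open>m / 2 + a\<close> for even \<open>m\<close> and
  \<open>(m + 1) / 2\<close> for odd \<open>m\<close>, which gives the slope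
  \<open>min a (1/2)\<close>. Their increments alternate between \<open>1 - a\<close> and
  \<open>a\<close>, both of modulus at most \<open>1 + a\<close>.\<close>

lemma sqrt_jacobi_osp:
  assumes a: "0 < a"
  shows "sqrt_jacobi (osp_coeff a) (min a (1/2)) (1 + a)"
proof
  fix m :: nat
  show "0 < osp_coeff a m" by (rule osp_coeff_pos[OF a])
  show "0 < min a (1/2)" using a by simp
  let ?c = "min a (1/2)"
  have le: "?c * (real m + 1) \<le> real m / 2 + ?c"
    using mult_right_mono[of ?c "1/2" "real m"] by (simp add: algebra_simps)
  have le': "?c * (real m + 1) \<le> (real m + 1) / 2"
    using mult_right_mono[of ?c "1/2" "real m + 1"] by linarith
  show "?c * (real m + 1) \<le> (osp_coeff a m)\<^sup>2"
  proof (cases "even m")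
    case True
    then obtain n where m: "m = 2 * n" by blast
    show ?thesis using le a unfolding m osp_coeff_even by (simp add: min_def split: if_splits)
  next
    case False
    then obtain n where m: "m = Suc (2 * n)" using oddE by fastforce
    have "(osp_coeff a m)\<^sup>2 = (real m + 1) / 2" unfolding m osp_coeff_odd by simp
    with le' show ?thesis by (simp only:)
  qed
  show "\<bar>(osp_coeff a (Suc m))\<^sup>2 - (osp_coeff a m)\<^sup>2\<bar> \<le> 1 + a"
  proof (cases "even m")
    case True
    then obtain n where m: "m = 2 * n" by blast
    show ?thesis using a unfolding m osp_coeff_even osp_coeff_odd by simp
  next
    case False
    then obtain n where m: "m = Suc (2 * n)" using oddE by fastforce
    show ?thesis using a osp_coeff_even[of a "Suc n"] unfolding m osp_coeff_odd by simp
  qed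
qed

lemma sqrt2_osp_coeff:
  "sqrt 2 * osp_coeff a k = (if even k then sqrt (2 * (real (k div 2) + a)) else sqrt (2 * (real (k div 2) + 1)))"
  unfolding osp_coeff_def real_sqrt_mult by simp

lemma b_plus_basis_eq: "b_plus_basis a k m = of_real (sqrt 2 * osp_coeff a k) * basis_vec (Suc k) m"
  unfolding b_plus_basis_def Let_def sqrt2_osp_coeff
  by (cases "even k") (auto elim!: evenE oddE)

lemma b_minus_basis_0: "b_minus_basis a 0 m = 0"
  by (simp add: b_minus_basis_def)

lemma b_minus_basis_Suc: "b_minus_basis a (Suc j) m = of_real (sqrt 2 * osp_coeff a j) * basis_vec j m"
  unfolding b_minus_basis_def Let_def sqrt2_osp_coeff
  by (cases "even j") (auto simp: add.commute elim!: evenE oddE)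

text \<open>For positive \<open>a\<close> no coefficient vanishes, so the index set in
  \<open>formal_ext\<close> is exactly the one column that reaches row \<open>m\<close>.\<close>

lemma b_plus_eq:
  assumes "0 < a"
  shows "b_plus a v m = (case m of 0 \<Rightarrow> 0 | Suc k \<Rightarrow> of_real (sqrt 2 * osp_coeff a k) * v k)"
proof -
  have nz: "osp_coeff a k \<noteq> 0" for k using osp_coeff_pos[OF assms, of k] by simp
  have "{n. b_plus_basis a n m \<noteq> 0} = (case m of 0 \<Rightarrow> {} | Suc k \<Rightarrow> {k})"
    using nz by (auto simp: b_plus_basis_eq basis_vec_def split: nat.splits)
  then show ?thesis
    by (cases m) (simp_all add: b_plus_def formal_ext_def b_plus_basis_eq basis_vec_def)
qed

lemma b_minus_eq:
  assumes "0 < a"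
  shows "b_minus a v m = of_real (sqrt 2 * osp_coeff a m) * v (Suc m)"
proof -
  have nz: "osp_coeff a k \<noteq> 0" for k using osp_coeff_pos[OF assms, of k] by simp
  have "b_minus_basis a n m \<noteq> 0 \<longleftrightarrow> n = Suc m" for n
    using nz by (cases n) (auto simp: b_minus_basis_0 b_minus_basis_Suc basis_vec_def)
  then have "{n. b_minus_basis a n m \<noteq> 0} = {Suc m}" by simp
  then show ?thesis
    by (simp add: b_minus_def formal_ext_def b_minus_basis_Suc basis_vec_def)
qed

lemma x_hat_eq_jacobi:
  assumes "0 < a" shows "x_hat a = jacobi (osp_coeff a)"
proof (intro ext)
  fix v m
  have "complex_of_real (sqrt 2) \<noteq> 0" by simp
  then show "x_hat a v m = jacobi (osp_coeff a) v m"
    by (cases m) (simp_all add: x_hat_def b_plus_eq b_minus_eq assms jacobi_0 jacobi_Suc field_simps del: of_real_eq_0_iff)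
qed

text \<open>The raising part contributes \<open>\<i> * \<i> ^ (m - 1)\<close> and the lowering part
  \<open>- \<i> * \<i> ^ (m + 1)\<close>; both equal \<open>\<i> ^ m\<close>, so the minus sign of
  \<open>p_hat\<close> becomes the plus sign of \<open>x_hat\<close>.\<close>

lemma p_hat_twist:
  assumes "0 < a"
  shows "p_hat a (\<lambda>n. \<i> ^ n * v n) = (\<lambda>n. \<i> ^ n * x_hat a v n)"
proof
  fix m
  have "complex_of_real (sqrt 2) \<noteq> 0" by simp
  then show "p_hat a (\<lambda>n. \<i> ^ n * v n) m = \<i> ^ m * x_hat a v m"
    by (cases m) (simp_all add: p_hat_def x_hat_def b_plus_eq b_minus_eq assms field_simps del: of_real_eq_0_iff)
qed

section \<open>Contiguous relations and the explicit eigenvectors\<close>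

lemma hyp1F1_extend: "hyp1F1 n c z = (\<Sum>k\<le>Suc n. pochhammer (- real n) k / (pochhammer c k * fact k) * z ^ k)"
proof -
  have "pochhammer (- real n) (Suc n) = 0" by (simp add: pochhammer_of_nat_eq_0_iff)
  then show ?thesis by (simp add: hyp1F1_def)
qed

lemma pochhammer_neg_Suc_Suc: "pochhammer (- real (Suc n)) (Suc k) = - real (Suc n) * pochhammer (- real n) k"
  by (simp add: pochhammer_rec del: of_nat_Suc) (simp add: algebra_simps)

text \<open>Coefficients are compared after an index shift, using
  \<open>(-n)_(k+1) - (-n-1)_(k+1) = (k+1) (-n)_k\<close> for Pochhammer symbols. In Laguerre form,
  with \<open>c = \<alpha> + 1\<close>, this is \<open>z * L_n^(\<alpha>+1) = (n+\<alpha>+1) *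
  L_n^(\<alpha>) - (n+1) * L_(n+1)^(\<alpha>)\<close>.\<close>

lemma hyp1F1_diff_Suc:
  assumes c: "0 < c"
  shows "hyp1F1 n c z - hyp1F1 (Suc n) c z = z / c * hyp1F1 n (c + 1) z"
proof -
  have coeff: "pochhammer (- real n) (Suc k) / (pochhammer c (Suc k) * fact (Suc k)) * z ^ Suc k
      - pochhammer (- real (Suc n)) (Suc k) / (pochhammer c (Suc k) * fact (Suc k)) * z ^ Suc k
    = z / c * (pochhammer (- real n) k / (pochhammer (c + 1) k * fact k) * z ^ k)" for k
  proof -
    have "pochhammer (- real n) (Suc k) - pochhammer (- real (Suc n)) (Suc k) = (1 + real k) * pochhammer (- real n) k"
      unfolding pochhammer_neg_Suc_Suc[of n k] pochhammer_Suc[of "- real n" k] by (simp add: algebra_simps)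
    moreover have "pochhammer c (Suc k) * fact (Suc k) = c * (1 + real k) * (pochhammer (c + 1) k * fact k)"
      unfolding pochhammer_rec by simp
    ultimately have "(pochhammer (- real n) (Suc k) - pochhammer (- real (Suc n)) (Suc k))
        / (pochhammer c (Suc k) * fact (Suc k)) = pochhammer (- real n) k / (pochhammer (c + 1) k * fact k) / c"
      by (simp del: fact_Suc of_nat_Suc)
    note quotient = this
    show ?thesis
      unfolding left_diff_distrib[symmetric] diff_divide_distrib[symmetric] quotient by (simp add: mult_ac)
  qed
  have "hyp1F1 n c z - hyp1F1 (Suc n) c z
    = (\<Sum>k\<le>Suc n. pochhammer (- real n) k / (pochhammer c k * fact k) * z ^ k
        - pochhammer (- real (Suc n)) k / (pochhammer c k * fact k) * z ^ k)"
    by (simp only: hyp1F1_extend[of n] hyp1F1_def[of "Suc n"] sum_subtractf)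
  also have "\<dots> = (\<Sum>k\<le>n. z / c * (pochhammer (- real n) k / (pochhammer (c + 1) k * fact k) * z ^ k))"
    by (simp only: sum.atMost_Suc_shift coeff) simp
  finally show ?thesis by (simp add: hyp1F1_def sum_distrib_left)
qed

text \<open>The Laguerre relation
  \<open>L_(n+1)^(\<alpha>) = L_(n+1)^(\<alpha>+1) - L_n^(\<alpha>+1)\<close> with
  \<open>c = \<alpha> + 1\<close>, again compared coefficientwise.\<close>

lemma hyp1F1_Suc_contiguous:
  assumes c: "0 < c"
  shows "(real (Suc n) + c) * hyp1F1 (Suc n) (c + 1) z - real (Suc n) * hyp1F1 n (c + 1) z
    = c * hyp1F1 (Suc n) c z"
proof -
  have coeff: "(real (Suc n) + c) * (pochhammer (- real (Suc n)) k / (pochhammer (c + 1) k * fact k))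
      - real (Suc n) * (pochhammer (- real n) k / (pochhammer (c + 1) k * fact k))
    = c * (pochhammer (- real (Suc n)) k / (pochhammer c k * fact k))" for k
  proof (cases k)
    case (Suc j)
    let ?P = "pochhammer (- real n) j" and ?Q = "pochhammer (c + 1) j"
    have Q: "0 < ?Q" using c by (intro pochhammer_pos) simp
    have cj: "0 < c + 1 + real j" using c by simp
    have Qk: "pochhammer (c + 1) (Suc j) = ?Q * (c + 1 + real j)"
      by (simp add: pochhammer_Suc)
    have ck: "pochhammer c (Suc j) = c * ?Q" by (rule pochhammer_rec)
    have Pk: "pochhammer (- real n) (Suc j) = ?P * (real j - real n)" by (simp add: pochhammer_Suc)
    have num: "(real (Suc n) + c) * (- real (Suc n) * ?P) - real (Suc n) * (?P * (real j - real n))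
        = - real (Suc n) * ?P * (c + 1 + real j)"
      by (simp add: algebra_simps)
    have "(real (Suc n) + c) * (pochhammer (- real (Suc n)) k / (pochhammer (c + 1) k * fact k))
      - real (Suc n) * (pochhammer (- real n) k / (pochhammer (c + 1) k * fact k))
      = (- real (Suc n) * ?P * (c + 1 + real j)) / (?Q * (c + 1 + real j) * fact k)"
      unfolding Suc pochhammer_neg_Suc_Suc Qk Pk num[symmetric] by (simp only: diff_divide_distrib times_divide_eq_right)
    also have "\<dots> = (- real (Suc n) * ?P) / (?Q * fact k)"
      using cj by (simp del: of_nat_Suc)
    also have "\<dots> = c * (pochhammer (- real (Suc n)) k / (pochhammer c k * fact k))"
      unfolding Suc pochhammer_neg_Suc_Suc ck using c by (simp del: of_nat_Suc fact_Suc)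
    finally show ?thesis .
  qed simp
  have "(real (Suc n) + c) * hyp1F1 (Suc n) (c + 1) z - real (Suc n) * hyp1F1 n (c + 1) z
    = (\<Sum>k\<le>Suc n. ((real (Suc n) + c) * (pochhammer (- real (Suc n)) k / (pochhammer (c + 1) k * fact k))
      - real (Suc n) * (pochhammer (- real n) k / (pochhammer (c + 1) k * fact k))) * z ^ k)"
    by (simp only: hyp1F1_extend[of n] hyp1F1_def[of "Suc n"] sum_distrib_left sum_subtractf[symmetric]
        left_diff_distrib mult.assoc)
  also have "\<dots> = c * hyp1F1 (Suc n) c z"
    by (simp only: coeff hyp1F1_def sum_distrib_left mult.assoc)
  finally show ?thesis .
qed

text \<open>The normalisation that both parities of \<open>beta\<close> share, so that the three-term recurrence
  reduces to the contiguous relations.\<close>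

definition beta_norm :: "real \<Rightarrow> nat \<Rightarrow> real" where
  "beta_norm a n = (-1) ^ n * sqrt (pochhammer a n / fact n)"

definition beta_weight :: "real \<Rightarrow> real \<Rightarrow> real" where
  "beta_weight a p = abs_pow p (a - 1/2) * exp (- (p\<^sup>2) / 2) / sqrt (Gamma a)"

lemma beta_even: "beta a (2 * n) p = beta_norm a n * beta_weight a p * hyp1F1 n a (p\<^sup>2)"
  by (simp add: beta_def beta_norm_def beta_weight_def)

text \<open>\<open>Gamma (a + 1) = a * Gamma a\<close> and the matching Pochhammer shift express the
  odd coefficients by the even normalisation.\<close>

lemma beta_odd:
  assumes a: "0 < a"
  shows "beta a (Suc (2 * n)) p
    = beta_norm a n * sqrt (real n + a) * p * beta_weight a p * hyp1F1 n (a + 1) (p\<^sup>2) / a"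
proof -
  have G: "sqrt (Gamma (a + 1)) = sqrt a * sqrt (Gamma a)"
    using Gamma_plus1[of a] a by (metis nonpos_Ints_nonpos not_less real_sqrt_mult)
  have "a * pochhammer (a + 1) n = (real n + a) * pochhammer a n"
    using pochhammer_rec[of a n] pochhammer_Suc[of a n] by (simp add: algebra_simps)
  then have "pochhammer (a + 1) n / fact n = (real n + a) * (pochhammer a n / fact n) / a"
    using a by (simp add: field_simps)
  then have P: "sqrt (pochhammer (a + 1) n / fact n) = sqrt (real n + a) * sqrt (pochhammer a n / fact n) / sqrt a"
    by (simp only: real_sqrt_mult real_sqrt_divide)
  have "sqrt a * sqrt a = a" using a by simp
  then show ?thesis
    unfolding beta_def Let_def beta_norm_def beta_weight_def using a
    by (simp add: G P divide_simps)
qed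

text \<open>The sign \<open>(-1) ^ n\<close> produces the minus that turns the sums in the Jacobi
  rows into the differences of the contiguous relations.\<close>

lemma beta_norm_Suc:
  assumes a: "0 < a"
  shows "sqrt (real n + 1) * beta_norm a (Suc n) = - (sqrt (real n + a) * beta_norm a n)"
proof -
  have "(real n + 1) * (pochhammer a (Suc n) / fact (Suc n)) = (real n + a) * (pochhammer a n / fact n)"
  proof -
    have cancel: "(real n + 1) * (x / ((real n + 1) * y)) = x / y" for x y :: real by simp
    have "fact (Suc n) = (real n + 1) * fact n" by simp
    then show ?thesis by (simp only: pochhammer_Suc cancel) simp
  qed
  then have "sqrt (real n + 1) * sqrt (pochhammer a (Suc n) / fact (Suc n))
      = sqrt (real n + a) * sqrt (pochhammer a n / fact n)"
    by (simp only: real_sqrt_mult[symmetric])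
  then show ?thesis by (simp add: beta_norm_def mult.left_commute)
qed

lemma beta_recurrence_odd:
  assumes a: "0 < a"
  shows "osp_coeff a (2 * n) * beta a (2 * n) p + osp_coeff a (Suc (2 * n)) * beta a (Suc (Suc (2 * n))) p
    = p * beta a (Suc (2 * n)) p"
proof -
  have "beta a (Suc (Suc (2 * n))) p = beta_norm a (Suc n) * beta_weight a p * hyp1F1 (Suc n) a (p\<^sup>2)"
    using beta_even[of a "Suc n" p] by simp
  then have "osp_coeff a (2 * n) * beta a (2 * n) p + osp_coeff a (Suc (2 * n)) * beta a (Suc (Suc (2 * n))) p
    = sqrt (real n + a) * beta_norm a n * beta_weight a p * hyp1F1 n a (p\<^sup>2)
      + (sqrt (real n + 1) * beta_norm a (Suc n)) * beta_weight a p * hyp1F1 (Suc n) a (p\<^sup>2)"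
    by (simp add: osp_coeff_even osp_coeff_odd beta_even)
  also have "\<dots> = sqrt (real n + a) * beta_norm a n * beta_weight a p
      * (hyp1F1 n a (p\<^sup>2) - hyp1F1 (Suc n) a (p\<^sup>2))"
    unfolding beta_norm_Suc[OF a] by (simp add: algebra_simps)
  also have "\<dots> = p * beta a (Suc (2 * n)) p"
    unfolding hyp1F1_diff_Suc[OF a] beta_odd[OF a] by (simp add: power2_eq_square algebra_simps)
  finally show ?thesis .
qed

lemma beta_recurrence_even:
  assumes a: "0 < a"
  shows "osp_coeff a (Suc (2 * n)) * beta a (Suc (2 * n)) p
      + osp_coeff a (Suc (Suc (2 * n))) * beta a (Suc (Suc (Suc (2 * n)))) p
    = p * beta a (Suc (Suc (2 * n))) p"
proof -
  let ?W = "p * beta_weight a p / a" and ?N = "beta_norm a (Suc n)"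
  have b2: "beta a (Suc (Suc (2 * n))) p = ?N * beta_weight a p * hyp1F1 (Suc n) a (p\<^sup>2)"
    using beta_even[of a "Suc n" p] by simp
  have b3: "beta a (Suc (Suc (Suc (2 * n)))) p = ?N * sqrt (real (Suc n) + a) * ?W * hyp1F1 (Suc n) (a + 1) (p\<^sup>2)"
    using beta_odd[OF a, of "Suc n" p] by simp
  have c2: "osp_coeff a (Suc (Suc (2 * n))) = sqrt (real (Suc n) + a)"
    using osp_coeff_even[of a "Suc n"] by simp
  have sq: "sqrt (real (Suc n) + a) * sqrt (real (Suc n) + a) = real (Suc n) + a"
    "sqrt (real n + 1) * sqrt (real n + 1) = real (Suc n)"
    using a by simp_all
  have "osp_coeff a (Suc (2 * n)) * beta a (Suc (2 * n)) p
      = - sqrt (real n + 1) * (- (sqrt (real n + a) * beta_norm a n)) * ?W * hyp1F1 n (a + 1) (p\<^sup>2)"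
    by (simp add: osp_coeff_odd beta_odd[OF a])
  also have "\<dots> = - (sqrt (real n + 1) * sqrt (real n + 1)) * ?N * ?W * hyp1F1 n (a + 1) (p\<^sup>2)"
    unfolding beta_norm_Suc[OF a, symmetric] by (simp only: mult.assoc mult_minus_left)
  finally have t1: "osp_coeff a (Suc (2 * n)) * beta a (Suc (2 * n)) p
      = - real (Suc n) * ?N * ?W * hyp1F1 n (a + 1) (p\<^sup>2)" unfolding sq .
  have t2: "osp_coeff a (Suc (Suc (2 * n))) * beta a (Suc (Suc (Suc (2 * n)))) p
      = (sqrt (real (Suc n) + a) * sqrt (real (Suc n) + a)) * ?N * ?W * hyp1F1 (Suc n) (a + 1) (p\<^sup>2)"
    unfolding c2 b3 by (simp only: mult_ac)
  have "osp_coeff a (Suc (2 * n)) * beta a (Suc (2 * n)) p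
      + osp_coeff a (Suc (Suc (2 * n))) * beta a (Suc (Suc (Suc (2 * n)))) p
    = ?N * ?W * ((real (Suc n) + a) * hyp1F1 (Suc n) (a + 1) (p\<^sup>2) - real (Suc n) * hyp1F1 n (a + 1) (p\<^sup>2))"
    unfolding t1 t2 sq by (simp add: algebra_simps del: of_nat_Suc)
  also have "\<dots> = p * beta a (Suc (Suc (2 * n))) p"
    unfolding hyp1F1_Suc_contiguous[OF a] b2 using a by simp
  finally show ?thesis .
qed

lemma jacobi_beta:
  assumes a: "0 < a"
  shows "jacobi (osp_coeff a) (\<lambda>n. complex_of_real (beta a n p)) m = complex_of_real p * complex_of_real (beta a m p)"
proof (cases m)
  case 0
  \<comment> \<open>Row 0 has no lower neighbour and lies outside both recurrences; there
    \<open>hyp1F1 0\<close> is 1 on both sides.\<close>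
  have "osp_coeff a 0 * beta a (Suc 0) p = (sqrt a * sqrt a) * (p * beta a 0 p) / a"
    using beta_odd[OF a, of 0 p] beta_even[of a 0 p] osp_coeff_even[of a 0]
    by (simp add: hyp1F1_def mult_ac del: real_sqrt_mult_self)
  then have "osp_coeff a 0 * beta a (Suc 0) p = p * beta a 0 p"
    using a by simp
  then show ?thesis by (simp add: 0 jacobi_0 flip: of_real_mult)
next
  case (Suc k)
  have "osp_coeff a k * beta a k p + osp_coeff a (Suc k) * beta a (Suc (Suc k)) p = p * beta a (Suc k) p"
  proof (cases "even k")
    case True
    then obtain n where "k = 2 * n" by blast
    then show ?thesis using beta_recurrence_odd[OF a] by simp
  next
    case False
    then obtain n where "k = Suc (2 * n)" using oddE by fastforce
    then show ?thesis using beta_recurrence_even[OF a] by simp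
  qed
  then show ?thesis by (simp add: Suc jacobi_Suc flip: of_real_mult of_real_add)
qed

theorem theorem4:
  fixes a :: real
  assumes "a > 0"
  shows "(\<forall>p::real. formal_eigenvector (p_hat a) (complex_of_real p) (w_vec a p)) \<and>
         (\<forall>p::real. p \<noteq> 0 \<longrightarrow> w_vec a p \<noteq> (\<lambda>n. 0)) \<and>
         op_spectrum (closure_graph (x_hat a)) = \<real> \<and>
         op_spectrum (closure_graph (p_hat a)) = \<real>"
proof (intro conjI allI impI)
  fix p :: real
  show "formal_eigenvector (p_hat a) (complex_of_real p) (w_vec a p)"
    unfolding formal_eigenvector_def w_vec_def p_hat_twist[OF assms] x_hat_eq_jacobi[OF assms]
      jacobi_beta[OF assms] by (simp add: mult.left_commute)
next
  fix p :: real
  assume "p \<noteq> 0"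
  moreover have "Gamma a \<noteq> 0" using Gamma_real_pos[OF assms] by linarith
  \<comment> \<open>The coefficient at index 0 has hypergeometric factor 1, and
    \<open>p \<noteq> 0\<close> keeps \<open>abs_pow\<close> away from zero.\<close>
  ultimately have "beta a 0 p \<noteq> 0"
    by (simp add: beta_def hyp1F1_def abs_pow_def)
  then have "w_vec a p 0 \<noteq> 0" by (simp add: w_vec_def)
  then show "w_vec a p \<noteq> (\<lambda>n. 0)" by auto
next
  interpret sqrt_jacobi "osp_coeff a" "min a (1/2)" "1 + a" by (rule sqrt_jacobi_osp[OF assms])
  show x: "op_spectrum (closure_graph (x_hat a)) = \<real>"
    unfolding x_hat_eq_jacobi[OF assms] by (rule spectrum_jacobi)
  have "op_spectrum (closure_graph (p_hat a)) = op_spectrum (closure_graph (x_hat a))"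
    by (rule op_spectrum_twist[of "\<lambda>n. \<i> ^ n"]) (simp_all add: norm_power p_hat_twist[OF assms])
  then show "op_spectrum (closure_graph (p_hat a)) = \<real>" using x by simp
qed

end
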